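(* Let $d\ge 3$, $n\ge 2$ be integers. There exists a proper algebraic subvariety $\Sigma_1(n,d)\subset\mathrm{Sym}(n,d,\mathbb{C})$ with the following properties. Let $\mathcal{T}\in\mathrm{Sym}(n,d)\setminus\Sigma_1(n,d)$ and consider the nonzero critical values of $f(\mathbf{x})=\langle\mathcal{T},\otimes^d\mathbf{x}\rangle$ on $\mathrm{S}^{n-1}$ and the corresponding critical points. Then: (1) If $d$ is odd, there are $N(\mathcal{T})\le\frac{2((d-1)^n-1)}{d-2}$ distinct nonzero critical values; each nonzero critical value $\lambda$ has a unique corresponding critical point $\mathbf{x}\in\mathrm{S}^{n-1}$, and $-\lambda$ is also a critical value, with unique corresponding critical point $-\mathbf{x}$. (2) If $d$ is even, there are $N(\mathcal{T})\le\frac{2((d-1)^n-1)}{d-2}$ distinct nonzero critical values; each nonzero critical value $\lambda$ has exactly two critical points $\pm\mathbf{x}\in\mathrm{S}^{n-1}$, and any two distinct nonzero critical values have distinct absolute values.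
   Context: $\mathrm{Sym}(n,d,\mathbb{C})$ is the space of complex tensors $[t_{i_1,\ldots,i_d}]_{i_1,\ldots,i_d=1}^n$ with entries invariant under any permutation of indices; $\mathrm{Sym}(n,d)$ is its real subspace of real symmetric tensors. For $\mathbf{x}\in\mathbb{R}^n$, $\otimes^d\mathbf{x}=\mathbf{x}\otimes\cdots\otimes\mathbf{x}$ ($d$ factors) and $\langle\mathcal{T},\otimes^d\mathbf{x}\rangle=\sum t_{i_1,\ldots,i_d}x_{i_1}\cdots x_{i_d}$. $\mathrm{S}^{n-1}$ is the Euclidean unit sphere in $\mathbb{R}^n$. A point $\mathbf{x}\in\mathrm{S}^{n-1}$ is a critical point of $f$ on $\mathrm{S}^{n-1}$ with critical value $\lambda=f(\mathbf{x})$ iff $\mathcal{T}\times\otimes^{d-1}\mathbf{x}=\lambda\mathbf{x}$, where $(\mathcal{T}\times\otimes^{d-1}\mathbf{x})_i=\sum_{i_2,\ldots,i_d}t_{i,i_2,\ldots,i_d}x_{i_2}\cdots x_{i_d}$. *)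

theory Defs
  imports "HOL-Analysis.Analysis"
begin

text \<open>Tensors of order d on C^n: functions on index lists [i_1,...,i_d] (0-based, i_k < n),
  zero outside the valid index set.\<close>

definition tindices :: "nat \<Rightarrow> nat \<Rightarrow> nat list set" where
  "tindices n d = {ix. length ix = d \<and> set ix \<subseteq> {..<n}}"

definition sym_tensors :: "nat \<Rightarrow> nat \<Rightarrow> (nat list \<Rightarrow> complex) set" where
  "sym_tensors n d = {T. (\<forall>ix. ix \<notin> tindices n d \<longrightarrow> T ix = 0) \<and>
      (\<forall>ix\<in>tindices n d. \<forall>jx\<in>tindices n d. mset ix = mset jx \<longrightarrow> T ix = T jx)}"

definition real_tensor :: "(nat list \<Rightarrow> complex) \<Rightarrow> bool" where
  "real_tensor T \<longleftrightarrow> (\<forall>ix. T ix \<in> \<real>)"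

inductive_set poly_fun :: "((nat list \<Rightarrow> complex) \<Rightarrow> complex) set" where
  pf_const: "(\<lambda>T. c) \<in> poly_fun"
| pf_coord: "(\<lambda>T. T ix) \<in> poly_fun"
| pf_add: "p \<in> poly_fun \<Longrightarrow> q \<in> poly_fun \<Longrightarrow> (\<lambda>T. p T + q T) \<in> poly_fun"
| pf_mult: "p \<in> poly_fun \<Longrightarrow> q \<in> poly_fun \<Longrightarrow> (\<lambda>T. p T * q T) \<in> poly_fun"

definition proper_subvariety :: "nat \<Rightarrow> nat \<Rightarrow> (nat list \<Rightarrow> complex) set \<Rightarrow> bool" where
  "proper_subvariety n d \<Sigma> \<longleftrightarrow>
     (\<exists>P. finite P \<and> P \<subseteq> poly_fun \<and> \<Sigma> = {T \<in> sym_tensors n d. \<forall>p\<in>P. p T = 0})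
     \<and> \<Sigma> \<noteq> sym_tensors n d"

definition on_sphere :: "nat \<Rightarrow> (nat \<Rightarrow> real) \<Rightarrow> bool" where
  "on_sphere n x \<longleftrightarrow> (\<forall>i\<ge>n. x i = 0) \<and> (\<Sum>i<n. (x i)\<^sup>2) = 1"

definition tform :: "nat \<Rightarrow> nat \<Rightarrow> (nat list \<Rightarrow> complex) \<Rightarrow> (nat \<Rightarrow> real) \<Rightarrow> real" where
  "tform n d T x = (\<Sum>ix\<in>tindices n d. Re (T ix) * prod_list (map x ix))"

definition tcontract :: "nat \<Rightarrow> nat \<Rightarrow> (nat list \<Rightarrow> complex) \<Rightarrow> (nat \<Rightarrow> real) \<Rightarrow> nat \<Rightarrow> real" where
  "tcontract n d T x i = (\<Sum>ix\<in>tindices n (d - 1). Re (T (i # ix)) * prod_list (map x ix))"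

definition crit_point :: "nat \<Rightarrow> nat \<Rightarrow> (nat list \<Rightarrow> complex) \<Rightarrow> (nat \<Rightarrow> real) \<Rightarrow> real \<Rightarrow> bool" where
  "crit_point n d T x lam \<longleftrightarrow> on_sphere n x \<and> lam = tform n d T x \<and>
      (\<forall>i<n. tcontract n d T x i = lam * x i)"

definition nonzero_crit_values :: "nat \<Rightarrow> nat \<Rightarrow> (nat list \<Rightarrow> complex) \<Rightarrow> real set" where
  "nonzero_crit_values n d T = {lam. lam \<noteq> 0 \<and> (\<exists>x. crit_point n d T x lam)}"

end

(* Normalising an eigenvector as z = s x with s^(d-2) = 1/lambda turns the critical point equation into
   T z^(d-1) = z, a system of n equations of degree d-1. For the Fermat tensor every monomial with an
   exponent at least d-1 is directly rewritten to lower degree; that the corresponding (Macaulay)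
   linear systems are solvable is an open condition, so for generic T the (d-1)^n reduced monomials span
   the functions on any finite set of solutions. Hence there are at most (d-1)^n solutions, and each
   critical point accounts for d-2 nonzero ones, shared only with its antipode.

   That distinct critical pairs have distinct |lambda| is a dimension count: the tensors with two
   independent eigenvectors u, v of equal normalised length depend on fewer parameters than dim Sym,
   so counting monomials produces a nonzero polynomial vanishing on all of them. *)

theory Submission
  imports Defs
begin

subsection \<open>Linear algebra and polynomial functions\<close>

text \<open>The factor s is a complex root even when T is real, so the first half counts complex
  solutions. Zero is always one of them, which explains the -1 in (d-1)^n - 1. Only the degrees up
  to n(d-2) + 1 need control, because every monomial of at least that degree has a nonreduced factor
  of exactly that degree. This leaves finitely many open conditions, all satisfied by the Fermat
  tensor.

  The exceptional set of the second half is a projection of a set of triples (T, u, v), and a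
  projection comes without equations. Growth supplies one: on these triples the N independent
  entries of T are fractions, with a power of a 2x2 minor of u and v as denominator, in n - 1 + n +
  (N - 2n) = N - 1 parameters and one element quadratic over them. Hence they are algebraically
  dependent. Both eigenvectors are scaled by the same s, so that the bilinear sums u.u and v.v are
  both s^2, a polynomial relation; a difference in sign of the two critical values survives as a
  factor 1 or -1 in the equation of v.\<close>

lemma nontrivial_kernel_exists:
  fixes M :: "'k \<Rightarrow> 'j \<Rightarrow> 'f::field"
  assumes "finite J" "finite K" "card J < card K"
  shows "\<exists>c. (\<exists>k\<in>K. c k \<noteq> 0) \<and> (\<forall>j\<in>J. (\<Sum>k\<in>K. c k * M k j) = 0)"
  using assms
proof (induction J arbitrary: K M rule: finite_induct)
  case empty
  then obtain k where "k \<in> K" by fastforce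
  then show ?case by (intro exI[of _ "\<lambda>_. 1"]) auto
next
  case (insert j J)
  show ?case
  proof (cases "\<forall>k\<in>K. M k j = 0")
    case True
    have "card J < card K" using insert by simp
    from insert.IH[OF insert.prems(1) this, of M] show ?thesis using True by auto
  next
    case False
    then obtain p where p: "p \<in> K" "M p j \<noteq> 0" by blast
    define K' where "K' = K - {p}"
    have K: "K = insert p K'" "p \<notin> K'" "finite K'" using p insert.prems by (auto simp: K'_def)
    have "card J < card K'" using insert K by simp
    \<comment> \<open>Subtracting multiples of vector \<open>p\<close> clears coordinate
      \<open>j\<close> of all other vectors; \<open>s\<close> below records the total multiple of
      vector \<open>p\<close> that this uses.\<close>
    from insert.IH[OF K(3) this, of "\<lambda>k i. M k i - M k j / M p j * M p i"]
    obtain c where c: "\<exists>k\<in>K'. c k \<noteq> 0"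
      and z: "\<And>i. i \<in> J \<Longrightarrow> (\<Sum>k\<in>K'. c k * (M k i - M k j / M p j * M p i)) = 0" by blast
    define s where "s = - (\<Sum>k\<in>K'. c k * (M k j / M p j))"
    define c' where "c' = c(p := s)"
    have sum': "(\<Sum>k\<in>K. c' k * M k i) = s * M p i + (\<Sum>k\<in>K'. c k * M k i)" for i
    proof -
      have "(\<Sum>k\<in>K'. c' k * M k i) = (\<Sum>k\<in>K'. c k * M k i)"
        by (rule sum.cong) (use K in \<open>auto simp: c'_def\<close>)
      then show ?thesis using K by (simp add: c'_def)
    qed
    have "(\<Sum>k\<in>K. c' k * M k i) = 0" if i: "i \<in> insert j J" for i
    proof (cases "i = j")
      case True
      have "(\<Sum>k\<in>K'. c k * (M k j / M p j)) * M p j = (\<Sum>k\<in>K'. c k * M k j)"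
        using p by (simp add: sum_distrib_right)
      then show ?thesis using True by (simp add: sum' s_def)
    next
      case False
      then have "0 = (\<Sum>k\<in>K'. c k * M k i - c k * (M k j / M p j) * M p i)"
        using z[of i] i by (simp add: algebra_simps)
      also have "\<dots> = (\<Sum>k\<in>K'. c k * M k i) + s * M p i"
        by (simp add: sum_subtractf s_def sum_distrib_right)
      finally show ?thesis by (simp add: sum' add.commute)
    qed
    moreover have "\<exists>k\<in>K. c' k \<noteq> 0" using c K by (auto simp: c'_def)
    ultimately show ?thesis by blast
  qed
qed

lemma poly_fun_sum: "(\<And>i. i \<in> I \<Longrightarrow> f i \<in> poly_fun) \<Longrightarrow> (\<lambda>T. \<Sum>i\<in>I. f i T) \<in> poly_fun"
  by (induction I rule: infinite_finite_induct) (auto intro: poly_fun.intros)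

lemma poly_fun_prod: "(\<And>i. i \<in> I \<Longrightarrow> f i \<in> poly_fun) \<Longrightarrow> (\<lambda>T. \<Prod>i\<in>I. f i T) \<in> poly_fun"
  by (induction I rule: infinite_finite_induct) (auto intro: poly_fun.intros)

lemma poly_fun_power: "f \<in> poly_fun \<Longrightarrow> (\<lambda>T. f T ^ k) \<in> poly_fun"
  by (induction k) (auto intro: poly_fun.intros)

lemma poly_fun_diff:
  assumes "f \<in> poly_fun" "g \<in> poly_fun" shows "(\<lambda>T. f T - g T) \<in> poly_fun"
proof -
  have "(\<lambda>T. f T + (- 1) * g T) \<in> poly_fun"
    by (intro pf_add pf_mult pf_const assms)
  then show ?thesis by simp
qed

text \<open>Restriction to a line reduces questions of nonvanishing to univariate polynomials, which
  form an integral domain.\<close>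

lemma poly_fun_on_line:
  assumes "p \<in> poly_fun"
  shows "\<exists>q. \<forall>s. p (\<lambda>ix. A ix + s * B ix) = poly q s"
  using assms
proof induction
  case (pf_const c) show ?case by (rule exI[of _ "[:c:]"]) simp
next
  case (pf_coord ix) show ?case by (rule exI[of _ "[:A ix, B ix:]"]) simp
next
  case (pf_add p q) then show ?case by (metis poly_add)
next
  case (pf_mult p q) then show ?case by (metis poly_mult)
qed

lemma sym_tensors_line:
  "A \<in> sym_tensors n d \<Longrightarrow> B \<in> sym_tensors n d \<Longrightarrow>
   (\<lambda>ix. A ix + s * (B ix - A ix)) \<in> sym_tensors n d"
  unfolding sym_tensors_def mem_Collect_eq by (intro conjI allI ballI impI) (simp, metis)

text \<open>This is irreducibility of the space of symmetric tensors. On the line joining the two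
  witnesses both factors are nonzero univariate polynomials, as their values at s = 0 and s = 1
  show, so their product has a non-root.\<close>

lemma poly_fun_mult_nonzero:
  assumes pq: "p \<in> poly_fun" "q \<in> poly_fun"
    and A: "A \<in> sym_tensors n d" "p A \<noteq> 0" and B: "B \<in> sym_tensors n d" "q B \<noteq> 0"
  shows "\<exists>T\<in>sym_tensors n d. p T * q T \<noteq> 0"
proof -
  let ?L = "\<lambda>s ix. A ix + s * (B ix - A ix)"
  obtain p' where p': "\<And>s. p (?L s) = poly p' s" using poly_fun_on_line[OF pq(1)] by metis
  obtain q' where q': "\<And>s. q (?L s) = poly q' s" using poly_fun_on_line[OF pq(2)] by metis
  have "p' \<noteq> 0" using p'[of 0] A by auto
  moreover have "q' \<noteq> 0" using q'[of 1] B by auto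
  ultimately have "p' * q' \<noteq> 0" by simp
  then obtain s where "poly (p' * q') s \<noteq> 0" using poly_all_0_iff_0 by blast
  then have "p (?L s) * q (?L s) \<noteq> 0" by (simp add: p' q')
  then show ?thesis using sym_tensors_line[OF A(1) B(1)] by blast
qed

lemma poly_fun_prod_nonzero:
  assumes "finite I" "\<And>i. i \<in> I \<Longrightarrow> f i \<in> poly_fun"
    "\<And>i. i \<in> I \<Longrightarrow> \<exists>T\<in>sym_tensors n d. f i T \<noteq> 0"
  shows "\<exists>T\<in>sym_tensors n d. (\<Prod>i\<in>I. f i T) \<noteq> 0"
  using assms
proof (induction I rule: finite_induct)
  case empty
  have "(\<lambda>_. 0) \<in> sym_tensors n d" by (simp add: sym_tensors_def)
  then show ?case by auto
next
  case (insert i I)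
  then obtain A B where "A \<in> sym_tensors n d" "f i A \<noteq> 0"
    "B \<in> sym_tensors n d" "(\<Prod>i\<in>I. f i B) \<noteq> 0" by (metis insertI1 insertI2)
  then show ?case
    using poly_fun_mult_nonzero[of "f i" "\<lambda>T. \<Prod>i\<in>I. f i T"] poly_fun_prod[of I f] insert by simp
qed

text \<open>Fraction-free Gaussian elimination, pivoting on an entry that does not vanish at \<open>T0\<close>.\<close>

lemma generic_injectivity:
  assumes "finite C" and "\<And>i j. a i j \<in> poly_fun"
    and "\<And>x. (\<forall>i\<in>R. (\<Sum>j\<in>C. a i j T0 * x j) = 0) \<Longrightarrow> (\<forall>j\<in>C. x j = 0)"
  shows "\<exists>p\<in>poly_fun. p T0 \<noteq> 0 \<and>
    (\<forall>T. p T \<noteq> 0 \<longrightarrow> (\<forall>x. (\<forall>i\<in>R. (\<Sum>j\<in>C. a i j T * x j) = 0) \<longrightarrow> (\<forall>j\<in>C. x j = 0)))"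
  using assms
proof (induction C arbitrary: a rule: finite_induct)
  case empty
  show ?case by (rule bexI[of _ "\<lambda>_. 1"]) (auto intro: poly_fun.intros)
next
  case (insert l C)
  have split: "(\<Sum>j\<in>insert l C. a i j T * x j) = a i l T * x l + (\<Sum>j\<in>C. a i j T * x j)" for i T x
    using insert by simp
  obtain k where k: "k \<in> R" "a k l T0 \<noteq> 0"
  proof (rule ccontr)
    assume "\<not> thesis"
    then have 0: "\<forall>i\<in>R. a i l T0 = 0" using that by blast
    have "(\<Sum>j\<in>C. a i j T0 * (if j = l then 1 else 0)) = 0" for i
      by (rule sum.neutral) (use insert in auto)
    then have "\<forall>i\<in>R. (\<Sum>j\<in>insert l C. a i j T0 * (if j = l then 1 else 0)) = 0"
      unfolding split using 0 by simp
    from insert.prems(2)[OF this] show False by auto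
  qed
  define b where "b i j = (\<lambda>T. a k l T * a i j T - a i l T * a k j T)" for i j
  have b: "b i j \<in> poly_fun" for i j
    unfolding b_def by (intro poly_fun_diff pf_mult insert.prems)
  have bsum: "(\<Sum>j\<in>C. b i j T * x j) = a k l T * (\<Sum>j\<in>C. a i j T * x j) - a i l T * (\<Sum>j\<in>C. a k j T * x j)" for i T x
    unfolding b_def by (simp add: sum_distrib_left left_diff_distrib sum_subtractf mult.assoc)
  have inj: "\<forall>j\<in>C. x j = 0" if x: "\<forall>i\<in>R. (\<Sum>j\<in>C. b i j T0 * x j) = 0" for x
  proof -
    \<comment> \<open>A kernel vector of the eliminated system is extended by the value that row
      \<open>k\<close> forces on the unknown \<open>l\<close>; the original system at
      \<open>T0\<close> then annihilates it.\<close>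
    define y where "y = x(l := - (\<Sum>j\<in>C. a k j T0 * x j) / a k l T0)"
    have yC: "(\<Sum>j\<in>C. a i j T0 * y j) = (\<Sum>j\<in>C. a i j T0 * x j)" for i
      by (rule sum.cong) (use insert in \<open>auto simp: y_def\<close>)
    have "(\<Sum>j\<in>insert l C. a i j T0 * y j) = 0" if "i \<in> R" for i
    proof -
      have "a k l T0 * (\<Sum>j\<in>insert l C. a i j T0 * y j) = (\<Sum>j\<in>C. b i j T0 * x j)"
        unfolding split yC bsum using k by (simp add: y_def algebra_simps)
      then show ?thesis using x k that by simp
    qed
    then have "\<forall>j\<in>insert l C. y j = 0" by (intro insert.prems(2)) auto
    then show ?thesis using insert by (auto simp: y_def split: if_splits)
  qed
  obtain p where p: "p \<in> poly_fun" "p T0 \<noteq> 0"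
    and pinj: "\<And>T x. p T \<noteq> 0 \<Longrightarrow> (\<forall>i\<in>R. (\<Sum>j\<in>C. b i j T * x j) = 0) \<Longrightarrow> (\<forall>j\<in>C. x j = 0)"
    using insert.IH[of b, OF b inj] by blast
  have "\<forall>j\<in>insert l C. x j = 0"
    if T: "a k l T * p T \<noteq> 0" and x: "\<forall>i\<in>R. (\<Sum>j\<in>insert l C. a i j T * x j) = 0" for T x
  proof -
    have e: "(\<Sum>j\<in>C. a i j T * x j) = - (a i l T * x l)" if "i \<in> R" for i
      using x that unfolding split by (simp add: eq_neg_iff_add_eq_0 add.commute)
    have "\<forall>i\<in>R. (\<Sum>j\<in>C. b i j T * x j) = 0"
      unfolding bsum using e k by (simp add: algebra_simps)
    then have C: "\<forall>j\<in>C. x j = 0" using pinj[of T x] T by (metis mult_eq_0_iff)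
    then have "a k l T * x l = 0" using e[OF k(1)] by simp
    then show ?thesis using C T by simp
  qed
  moreover have "(\<lambda>T. a k l T * p T) \<in> poly_fun" by (intro pf_mult p insert.prems)
  ultimately show ?case using p k by (intro bexI[of _ "\<lambda>T. a k l T * p T"]) auto
qed

subsection \<open>The Bezout bound for generic tensors\<close>

abbreviation mset_monomial :: "(nat \<Rightarrow> complex) \<Rightarrow> nat multiset \<Rightarrow> complex" where
  "mset_monomial z A \<equiv> (\<Prod>i\<in>#A. z i)"

text \<open>Complex counterpart of \<open>tcontract\<close>, since eigenvectors get scaled by
  complex roots. The parameter \<open>D\<close> stands for d - 1 throughout, so tensors have order
  \<open>Suc D\<close>.\<close>

definition ccontract :: "nat \<Rightarrow> nat \<Rightarrow> (nat list \<Rightarrow> complex) \<Rightarrow> (nat \<Rightarrow> complex) \<Rightarrow> nat \<Rightarrow> complex" where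
  "ccontract n D T z i = (\<Sum>ix\<in>tindices n D. T (i # ix) * prod_list (map z ix))"

definition eigen_solutions :: "nat \<Rightarrow> nat \<Rightarrow> (nat list \<Rightarrow> complex) \<Rightarrow> (nat \<Rightarrow> complex) set" where
  "eigen_solutions n D T = {z. (\<forall>i\<ge>n. z i = 0) \<and> (\<forall>i<n. ccontract n D T z i = z i)}"

definition msets_of_degree :: "nat \<Rightarrow> nat \<Rightarrow> nat multiset set" where
  "msets_of_degree n j = mset ` tindices n j"

lemma msets_of_degree_iff: "A \<in> msets_of_degree n j \<longleftrightarrow> size A = j \<and> set_mset A \<subseteq> {..<n}"
proof
  assume "size A = j \<and> set_mset A \<subseteq> {..<n}"
  moreover obtain xs where "mset xs = A" using ex_mset by blast
  ultimately show "A \<in> msets_of_degree n j"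
    unfolding msets_of_degree_def tindices_def by (intro image_eqI[of _ _ xs]) auto
qed (auto simp: msets_of_degree_def tindices_def)

lemma finite_tindices [simp]: "finite (tindices n d)"
  using finite_lists_length_eq[of "{..<n}" d] by (simp add: tindices_def conj_commute)

lemma finite_msets_of_degree [simp]: "finite (msets_of_degree n j)"
  by (simp add: msets_of_degree_def)

section \<open>Reduced monomials and the Macaulay matrix\<close>

definition reduced :: "nat \<Rightarrow> nat multiset \<Rightarrow> bool" where
  "reduced D A \<longleftrightarrow> (\<forall>i. count A i < D)"

definition nonreduced :: "nat \<Rightarrow> nat \<Rightarrow> nat \<Rightarrow> nat multiset set" where
  "nonreduced n D j = {A \<in> msets_of_degree n j. \<not> reduced D A}"

definition pivot :: "nat \<Rightarrow> nat multiset \<Rightarrow> nat" where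
  "pivot D A = (LEAST i. D \<le> count A i)"

text \<open>Row \<open>A\<close> of a Macaulay matrix: with i the pivot of \<open>A\<close>,
  equation i is multiplied by the monomial of \<open>A\<close> divided by z_i^D, and entry
  \<open>C\<close> is the coefficient of the monomial \<open>C\<close> in the result. Several index
  lists yield the same monomial, hence the sum.\<close>

definition macaulay :: "nat \<Rightarrow> nat \<Rightarrow> nat multiset \<Rightarrow> nat multiset \<Rightarrow> (nat list \<Rightarrow> complex) \<Rightarrow> complex" where
  "macaulay n D A C T = (\<Sum>ix | ix \<in> tindices n D \<and> A - replicate_mset D (pivot D A) + mset ix = C.
      T (pivot D A # ix))"

lemma pivot_le: "\<not> reduced D A \<Longrightarrow> D \<le> count A (pivot D A)"
  unfolding pivot_def reduced_def by (rule LeastI_ex) (auto simp: not_less)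

lemma pivot_split:
  assumes "\<not> reduced D A"
  shows "A = (A - replicate_mset D (pivot D A)) + replicate_mset D (pivot D A)"
  using pivot_le[OF assms] by (simp add: count_le_replicate_mset_subset_eq)

lemma pivot_in:
  assumes "A \<in> nonreduced n D j" "D > 0" shows "pivot D A < n"
proof -
  have "count A (pivot D A) > 0" using pivot_le assms unfolding nonreduced_def
    by (metis (mono_tags, lifting) gr0I leD mem_Collect_eq)
  then show ?thesis using assms by (auto simp: nonreduced_def msets_of_degree_iff)
qed

lemma mset_monomial_mset: "mset_monomial z (mset ix) = prod_list (map z ix)"
  by (metis mset_map prod_mset_prod_list)

lemma pivot_diff:
  assumes "A \<in> nonreduced n D j"
  shows "set_mset (A - replicate_mset D (pivot D A)) \<subseteq> {..<n}"
    "size (A - replicate_mset D (pivot D A)) + D = j"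
proof -
  have A: "\<not> reduced D A" "size A = j" "set_mset A \<subseteq> {..<n}"
    using assms by (auto simp: nonreduced_def msets_of_degree_iff)
  show "set_mset (A - replicate_mset D (pivot D A)) \<subseteq> {..<n}"
    using A(3) by (meson in_diffD subsetD subsetI)
  show "size (A - replicate_mset D (pivot D A)) + D = j"
    using arg_cong[OF pivot_split[OF A(1)], of size] A(2) by simp
qed

text \<open>Equation \<open>pivot D A\<close> times the cofactor monomial. The right-hand side has
  degree \<open>j - D + 1\<close>, which is below \<open>j\<close> for \<open>D \<ge> 2\<close>;
  this drop drives the induction on the degree.\<close>

lemma macaulay_relation:
  assumes z: "z \<in> eigen_solutions n D T" and A: "A \<in> nonreduced n D j" and D: "D > 0"
  shows "(\<Sum>C\<in>msets_of_degree n j. macaulay n D A C T * mset_monomial z C) =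
    mset_monomial z (add_mset (pivot D A) (A - replicate_mset D (pivot D A)))"
proof -
  let ?i = "pivot D A" and ?B = "A - replicate_mset D (pivot D A)"
  have img: "(\<lambda>ix. ?B + mset ix) ` tindices n D \<subseteq> msets_of_degree n j"
    using pivot_diff[OF A] by (auto simp: msets_of_degree_iff tindices_def)
  have "mset_monomial z (add_mset ?i ?B) = mset_monomial z ?B * ccontract n D T z ?i"
    using z pivot_in[OF A D] by (simp add: eigen_solutions_def mult.commute)
  also have "\<dots> = (\<Sum>ix\<in>tindices n D. T (?i # ix) * mset_monomial z (?B + mset ix))"
    unfolding ccontract_def sum_distrib_left
    by (rule sum.cong) (auto simp flip: mset_monomial_mset)
  also have "\<dots> = (\<Sum>C\<in>msets_of_degree n j. \<Sum>ix | ix \<in> tindices n D \<and> ?B + mset ix = C.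
      T (?i # ix) * mset_monomial z (?B + mset ix))"
    by (rule sum.group[symmetric]) (use img in auto)
  also have "\<dots> = (\<Sum>C\<in>msets_of_degree n j. macaulay n D A C T * mset_monomial z C)"
    unfolding macaulay_def sum_distrib_right by (intro sum.cong) auto
  finally show ?thesis by simp
qed

text \<open>A reduced monomial is a vector of \<open>n\<close> exponents, each below
  \<open>D\<close>; this is where the Bezout number comes from.\<close>

lemma card_reduced_le:
  "finite {A. set_mset A \<subseteq> {..<n} \<and> reduced D A} \<and>
   card {A. set_mset A \<subseteq> {..<n} \<and> reduced D A} \<le> D ^ n"
proof -
  let ?R = "{A. set_mset A \<subseteq> {..<n} \<and> reduced D A}"
  let ?F = "PiE {..<n} (\<lambda>_. {..<D})"
  have inj: "inj_on (\<lambda>A. restrict (count A) {..<n}) ?R"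
  proof (rule inj_onI)
    fix A B assume A: "A \<in> ?R" and B: "B \<in> ?R"
      and eq: "restrict (count A) {..<n} = restrict (count B) {..<n}"
    have "count A i = count B i" for i
    proof (cases "i < n")
      case True then show ?thesis using fun_cong[OF eq, of i] by simp
    next
      case False
      then have "i \<notin># A" "i \<notin># B" using A B by auto
      then show ?thesis by (simp add: not_in_iff)
    qed
    then show "A = B" by (rule multiset_eqI)
  qed
  have sub: "(\<lambda>A. restrict (count A) {..<n}) ` ?R \<subseteq> ?F"
    by (intro image_subsetI restrict_PiE_iff[THEN iffD2]) (simp add: reduced_def)
  have fin: "finite ?F" by (simp add: finite_PiE)
  have "card ?R \<le> card ?F" by (rule card_inj_on_le[OF inj sub fin])
  moreover have "card ?F = D ^ n" by (simp add: card_PiE)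
  ultimately show ?thesis using inj_on_finite[OF inj sub fin] by simp
qed

lemma reduced_size:
  assumes "reduced D A" "set_mset A \<subseteq> {..<n}" shows "size A \<le> n * (D - 1)"
proof -
  have "size A = (\<Sum>i\<in>set_mset A. count A i)" by (simp add: size_multiset_overloaded_eq)
  also have "\<dots> \<le> (\<Sum>i\<in>{..<n}. count A i)" by (rule sum_mono2) (use assms in auto)
  also have "\<dots> \<le> (\<Sum>i\<in>{..<n}. D - 1)"
  proof (rule sum_mono)
    fix i
    have "count A i < D" using assms(1) by (simp add: reduced_def)
    then show "count A i \<le> D - 1" by simp
  qed
  finally show ?thesis by simp
qed

lemma ex_submset_of_size:
  fixes A :: "'a multiset"
  assumes "k \<le> size A" shows "\<exists>B C. A = B + C \<and> size B = k"
proof -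
  obtain xs where xs: "mset xs = A" using ex_mset by blast
  have "A = mset (take k xs) + mset (drop k xs)"
    using xs by (metis append_take_drop_id mset_append)
  moreover have "size (mset (take k xs)) = k" using assms xs by auto
  ultimately show ?thesis by blast
qed

text \<open>A functional supported on finitely many solutions that kills the reduced monomials kills all
  monomials, since injectivity of the Macaulay matrix determines the nonreduced ones of each degree
  from monomials of lower degree.\<close>

lemma functional_vanishes:
  assumes D: "D \<ge> 2" and S: "S \<subseteq> eigen_solutions n D T"
    and inj: "\<And>j x. j \<le> n * (D - 1) + 1 \<Longrightarrow>
       (\<forall>A\<in>nonreduced n D j. (\<Sum>C\<in>nonreduced n D j. macaulay n D A C T * x C) = 0) \<Longrightarrow>
       (\<forall>C\<in>nonreduced n D j. x C = 0)"
    and red: "\<And>A. set_mset A \<subseteq> {..<n} \<Longrightarrow> reduced D A \<Longrightarrow> (\<Sum>z\<in>S. c z * mset_monomial z A) = 0"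
    and A: "set_mset A \<subseteq> {..<n}"
  shows "(\<Sum>z\<in>S. c z * mset_monomial z A) = 0"
  using A
proof (induction A rule: measure_induct_rule[where f = "size :: nat multiset \<Rightarrow> nat"])
  case (less A)
  \<comment> \<open>The first degree in which no monomial is reduced, by
    \<open>reduced_size\<close>.\<close>
  define k where "k = n * (D - 1) + 1"
  show ?case
  proof (cases "reduced D A")
    case True then show ?thesis using red less.prems by blast
  next
    case False
    \<comment> \<open>Only matrices of degree at most \<open>k\<close> are known to be injective, so
      a factor \<open>B\<close> of degree at most \<open>k\<close> is rewritten while the cofactor
      \<open>B'\<close> is carried along.\<close>
    obtain B B' where B: "A = B + B'" "size B = min (size A) k"
      using ex_submset_of_size[of "min (size A) k" A] by auto
    have Bn: "set_mset B \<subseteq> {..<n}" "set_mset B' \<subseteq> {..<n}" using less.prems B by auto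
    have short: "B' = {#}" if "size A \<le> k"
      using B that arg_cong[OF B(1), of size] by simp
    have long: "\<not> reduced D C" if "size A > k" "C \<in> msets_of_degree n (size B)" for C
    proof
      assume "reduced D C"
      then have "size C \<le> n * (D - 1)" using that(2) by (intro reduced_size) (auto simp: msets_of_degree_iff)
      then show False using that B(2) unfolding msets_of_degree_iff k_def by linarith
    qed
    define j where "j = size B"
    have jk: "j \<le> k" using B by (simp add: j_def)
    have Bnr: "B \<in> nonreduced n D j"
    proof (cases "size A \<le> k")
      case True
      then have "B = A" using short B(1) by simp
      then show ?thesis using False less.prems by (simp add: nonreduced_def msets_of_degree_iff j_def)
    next
      case False
      moreover have "B \<in> msets_of_degree n (size B)" using Bn by (simp add: msets_of_degree_iff)
      ultimately show ?thesis using long by (simp add: nonreduced_def j_def)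
    qed
    define x where "x C = (\<Sum>z\<in>S. c z * mset_monomial z (C + B'))" for C
    \<comment> \<open>If \<open>A\<close> has degree at most \<open>k\<close>, then
      \<open>B'\<close> is empty and the hypothesis on reduced monomials applies; otherwise
      \<open>j\<close> equals \<open>k\<close> and there is no reduced \<open>C\<close>.\<close>
    have x0: "x C = 0" if "C \<in> msets_of_degree n j" "reduced D C" for C
    proof (cases "size A \<le> k")
      case True
      then show ?thesis using short red that by (simp add: x_def msets_of_degree_iff)
    next
      case False
      then show ?thesis using long that by (auto simp: j_def)
    qed
    have "\<forall>A\<in>nonreduced n D j. (\<Sum>C\<in>nonreduced n D j. macaulay n D A C T * x C) = 0"
    proof
      fix E assume E: "E \<in> nonreduced n D j"
      let ?E = "add_mset (pivot D E) (E - replicate_mset D (pivot D E))"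
      have "(\<Sum>C\<in>nonreduced n D j. macaulay n D E C T * x C) =
          (\<Sum>C\<in>msets_of_degree n j. macaulay n D E C T * x C)"
        by (rule sum.mono_neutral_left) (auto simp: nonreduced_def x0)
      also have "\<dots> = (\<Sum>C\<in>msets_of_degree n j. \<Sum>z\<in>S.
          c z * mset_monomial z B' * (macaulay n D E C T * mset_monomial z C))"
        unfolding x_def sum_distrib_left by (intro sum.cong) (auto simp: algebra_simps)
      also have "\<dots> = (\<Sum>z\<in>S. c z * mset_monomial z B' *
          (\<Sum>C\<in>msets_of_degree n j. macaulay n D E C T * mset_monomial z C))"
        unfolding sum_distrib_left by (rule sum.swap)
      also have "\<dots> = (\<Sum>z\<in>S. c z * mset_monomial z (?E + B'))"
        using macaulay_relation[OF _ E, of _ T] S D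
        by (intro sum.cong) (auto simp: algebra_simps subset_iff)
      also have "\<dots> = 0"
      proof (rule less.IH)
        show "size (?E + B') < size A" using pivot_diff(2)[OF E] D B(1) by (simp add: j_def)
        show "set_mset (?E + B') \<subseteq> {..<n}"
          using pivot_diff(1)[OF E] pivot_in[OF E] D Bn by auto
      qed
      finally show "(\<Sum>C\<in>nonreduced n D j. macaulay n D E C T * x C) = 0" .
    qed
    then have "\<forall>C\<in>nonreduced n D j. x C = 0" using inj jk k_def by blast
    then show ?thesis using Bnr B by (simp add: x_def)
  qed
qed

text \<open>Testing against a product of coordinate differences that vanishes at all points but one.\<close>

lemma functional_zero_if_kills_monomials:
  assumes fin: "finite S" and S: "\<And>z i. z \<in> S \<Longrightarrow> i \<ge> n \<Longrightarrow> z i = 0"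
    and kill: "\<And>A. set_mset A \<subseteq> {..<n} \<Longrightarrow> (\<Sum>z\<in>S. c z * mset_monomial z A) = 0"
    and w: "w \<in> S"
  shows "c w = 0"
proof -
  have "\<forall>y. \<exists>i. y \<in> S \<longrightarrow> y \<noteq> w \<longrightarrow> i < n \<and> w i \<noteq> y i"
    using S w by (metis ext not_less)
  then obtain i where i: "\<And>y. y \<in> S \<Longrightarrow> y \<noteq> w \<Longrightarrow> i y < n \<and> w (i y) \<noteq> y (i y)" by metis
  \<comment> \<open>The cofactor monomial is arbitrary because expanding one more difference
    multiplies it by a coordinate.\<close>
  have "(\<Sum>z\<in>S. c z * (\<Prod>y\<in>Y. z (i y) - y (i y)) * mset_monomial z A) = 0"
    if "finite Y" "Y \<subseteq> S - {w}" "set_mset A \<subseteq> {..<n}" for Y A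
    using that
  proof (induction Y arbitrary: A rule: finite_induct)
    case empty then show ?case using kill by simp
  next
    case (insert y Y)
    have y: "i y < n" using i insert.prems by auto
    have "(\<Sum>z\<in>S. c z * (\<Prod>y\<in>insert y Y. z (i y) - y (i y)) * mset_monomial z A) =
      (\<Sum>z\<in>S. c z * (\<Prod>y\<in>Y. z (i y) - y (i y)) * mset_monomial z (add_mset (i y) A))
      - y (i y) * (\<Sum>z\<in>S. c z * (\<Prod>y\<in>Y. z (i y) - y (i y)) * mset_monomial z A)"
      using insert.hyps by (simp add: sum_distrib_left sum_subtractf[symmetric] algebra_simps)
    also have "\<dots> = 0" using insert.IH[of "add_mset (i y) A"] insert.IH[of A] insert.prems y
      by (simp del: prod_mset.add_mset image_mset_add_mset)
    finally show ?case .
  qed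
  from this[of "S - {w}" "{#}"] have "(\<Sum>z\<in>S. c z * (\<Prod>y\<in>S-{w}. z (i y) - y (i y))) = 0"
    using fin by simp
  also have "(\<Sum>z\<in>S. c z * (\<Prod>y\<in>S-{w}. z (i y) - y (i y))) = c w * (\<Prod>y\<in>S-{w}. w (i y) - y (i y))"
    by (subst sum.remove[OF fin w]) (auto intro!: sum.neutral simp: fin)
  finally have "c w * (\<Prod>y\<in>S-{w}. w (i y) - y (i y)) = 0" .
  moreover have "(\<Prod>y\<in>S-{w}. w (i y) - y (i y)) \<noteq> 0" using i fin by auto
  ultimately show ?thesis by simp
qed

section \<open>The Fermat tensor as a witness of genericity\<close>

definition fermat_tensor :: "nat \<Rightarrow> nat \<Rightarrow> nat list \<Rightarrow> complex" where
  "fermat_tensor n d ix = (if \<exists>i<n. ix = replicate d i then 1 else 0)"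

lemma fermat_tensor_sym: "fermat_tensor n d \<in> sym_tensors n d"
proof -
  have "ix = replicate d i" if "mset ix = mset (replicate d i)" for ix :: "nat list" and i
    using mset_eq_length[OF that] mset_eq_setD[OF that]
    by (intro replicate_eqI) (auto split: if_splits)
  then have "(\<exists>i<n. ix = replicate d i) \<longleftrightarrow> (\<exists>i<n. mset ix = mset (replicate d i))" for ix
    by auto
  then have F: "fermat_tensor n d ix = (if \<exists>i<n. mset ix = mset (replicate d i) then 1 else 0)" for ix
    unfolding fermat_tensor_def by simp
  show ?thesis
    unfolding sym_tensors_def mem_Collect_eq
  proof (intro conjI allI ballI impI)
    fix ix assume "ix \<notin> tindices n d"
    then show "fermat_tensor n d ix = 0" by (auto simp: fermat_tensor_def tindices_def)
  next
    fix ix jx :: "nat list" assume "mset ix = mset jx"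
    then show "fermat_tensor n d ix = fermat_tensor n d jx" unfolding F by presburger
  qed
qed

text \<open>For the form x_1^d + ... + x_n^d the contraction has entries z_i^D, so multiplying by
  the cofactor gives back the monomial \<open>A\<close>. The matrix is the identity in every
  degree.\<close>

lemma macaulay_fermat:
  assumes A: "A \<in> nonreduced n D j" and D: "D > 0"
  shows "macaulay n D A C (fermat_tensor n (Suc D)) = (if C = A then 1 else 0)"
proof -
  let ?i = "pivot D A"
  have F: "fermat_tensor n (Suc D) (?i # ix) = (if ix = replicate D ?i then 1 else 0)" for ix
    using pivot_in[OF A D] by (auto simp: fermat_tensor_def)
  have mem: "replicate D ?i \<in> tindices n D" using pivot_in[OF A D] by (auto simp: tindices_def)
  have eq: "A - replicate_mset D ?i + replicate_mset D ?i = A"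
    using pivot_split[of D A] A by (simp add: nonreduced_def)
  show ?thesis
    unfolding macaulay_def F by (subst sum.delta) (auto simp: mem eq)
qed

text \<open>With more points than reduced monomials, some nonzero functional on the points kills all
  reduced monomials, hence all monomials, hence is zero. The bound speaks of finite subsets, as
  finiteness of the solution set is not known beforehand and \<open>card\<close> is 0 on infinite
  sets.\<close>

lemma generic_eigen_bound:
  assumes D: "D \<ge> 2"
  shows "\<exists>p\<in>poly_fun. (\<exists>T\<in>sym_tensors n (Suc D). p T \<noteq> 0) \<and>
    (\<forall>T. p T \<noteq> 0 \<longrightarrow> (\<forall>S. finite S \<longrightarrow> S \<subseteq> eigen_solutions n D T \<longrightarrow> card S \<le> D ^ n))"
proof -
  let ?K = "{..n * (D - 1) + 1}" and ?F = "fermat_tensor n (Suc D)"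
  define inj where "inj j T \<longleftrightarrow> (\<forall>x.
      (\<forall>A\<in>nonreduced n D j. (\<Sum>C\<in>nonreduced n D j. macaulay n D A C T * x C) = 0) \<longrightarrow>
      (\<forall>C\<in>nonreduced n D j. x C = 0))" for j T
  have "\<exists>p\<in>poly_fun. p ?F \<noteq> 0 \<and> (\<forall>T. p T \<noteq> 0 \<longrightarrow> inj j T)" for j
    unfolding inj_def
  proof (rule generic_injectivity)
    show "finite (nonreduced n D j)" by (simp add: nonreduced_def)
    show "macaulay n D A C \<in> poly_fun" for A C
      unfolding macaulay_def[abs_def] by (intro poly_fun_sum pf_coord)
    fix x assume x: "\<forall>A\<in>nonreduced n D j. (\<Sum>C\<in>nonreduced n D j. macaulay n D A C ?F * x C) = 0"
    have "x A = 0" if A: "A \<in> nonreduced n D j" for A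
    proof -
      have "0 = (\<Sum>C\<in>nonreduced n D j. macaulay n D A C ?F * x C)" using x A by simp
      also have "\<dots> = (\<Sum>C\<in>nonreduced n D j. (if C = A then x C else 0))"
        using D by (intro sum.cong refl) (simp add: macaulay_fermat[OF A])
      also have "\<dots> = x A" using A by (simp add: nonreduced_def)
      finally show ?thesis by simp
    qed
    then show "\<forall>C\<in>nonreduced n D j. x C = 0" by blast
  qed
  then obtain p where p: "\<And>j. p j \<in> poly_fun" "\<And>j. p j ?F \<noteq> 0"
    and p_inj: "\<And>j T. p j T \<noteq> 0 \<Longrightarrow> inj j T" by metis
  define P where "P T = (\<Prod>j\<in>?K. p j T)" for T
  have "card S \<le> D ^ n" if T: "P T \<noteq> 0" and S: "finite S" "S \<subseteq> eigen_solutions n D T" for T S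
  proof (rule ccontr)
    assume large: "\<not> card S \<le> D ^ n"
    let ?R = "{A. set_mset A \<subseteq> {..<n} \<and> reduced D A}"
    have "card ?R < card S" using card_reduced_le[of n D] large by simp
    then obtain c w where w: "w \<in> S" "c w \<noteq> 0"
      and c: "\<forall>A\<in>?R. (\<Sum>z\<in>S. c z * mset_monomial z A) = 0"
      using nontrivial_kernel_exists[of ?R S mset_monomial] card_reduced_le[of n D] S by blast
    have "c w = 0"
    proof (rule functional_zero_if_kills_monomials[OF S(1) _ _ w(1), of n])
      show "\<And>z i. z \<in> S \<Longrightarrow> i \<ge> n \<Longrightarrow> z i = 0" using S by (auto simp: eigen_solutions_def)
      fix A assume A: "set_mset A \<subseteq> {..<n}"
      show "(\<Sum>z\<in>S. c z * mset_monomial z A) = 0"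
      proof (rule functional_vanishes[OF D S(2) _ _ A])
        fix j x assume "j \<le> n * (D - 1) + 1"
          "\<forall>A\<in>nonreduced n D j. (\<Sum>C\<in>nonreduced n D j. macaulay n D A C T * x C) = 0"
        moreover have "p j T \<noteq> 0" using T calculation(1) unfolding P_def by (simp only: prod_zero_iff finite_atMost) auto
        ultimately show "\<forall>C\<in>nonreduced n D j. x C = 0" using p_inj[of j T] unfolding inj_def by blast
      qed (use c in auto)
    qed
    then show False using w by simp
  qed
  moreover have "P \<in> poly_fun" unfolding P_def[abs_def] by (intro poly_fun_prod p)
  moreover have "P ?F \<noteq> 0" using p by (simp add: P_def)
  ultimately show ?thesis using fermat_tensor_sym by blast
qed

subsection \<open>Algebraic dependence by counting monomials\<close>

definition lin_span :: "'x set \<Rightarrow> ('x \<Rightarrow> complex) set \<Rightarrow> ('x \<Rightarrow> complex) set" where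
  \<comment> \<open>Equality is required on \<open>X\<close> only, so that a relation valid just on
    the set of configurations, such as that between the norms, can be used.\<close>
  "lin_span X B = {f. \<exists>c. \<forall>x\<in>X. f x = (\<Sum>b\<in>B. c b * b x)}"

lemma lin_span_base:
  assumes "finite B" "b \<in> B" shows "b \<in> lin_span X B"
proof -
  have "b x = (\<Sum>b'\<in>B. (if b' = b then 1 else 0) * b' x)" for x
    using assms by (simp add: if_distrib[of "\<lambda>t. t * _"] cong: if_cong)
  then show ?thesis
    unfolding lin_span_def by (intro CollectI exI[of _ "\<lambda>b'. if b' = b then 1 else 0"]) simp
qed

lemma lin_span_cong:
  "f \<in> lin_span X B \<Longrightarrow> (\<And>x. x \<in> X \<Longrightarrow> g x = f x) \<Longrightarrow> g \<in> lin_span X B"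
  unfolding lin_span_def by auto

lemma lin_span_zero: "(\<lambda>x. 0) \<in> lin_span X B"
  unfolding lin_span_def by (intro CollectI exI[of _ "\<lambda>_. 0"]) simp

lemma lin_span_add:
  assumes "f \<in> lin_span X B" "g \<in> lin_span X B" shows "(\<lambda>x. f x + g x) \<in> lin_span X B"
proof -
  obtain c e where "\<forall>x\<in>X. f x = (\<Sum>b\<in>B. c b * b x)" "\<forall>x\<in>X. g x = (\<Sum>b\<in>B. e b * b x)"
    using assms unfolding lin_span_def by blast
  then show ?thesis unfolding lin_span_def
    by (intro CollectI exI[of _ "\<lambda>b. c b + e b"]) (simp add: sum.distrib distrib_right)
qed

lemma lin_span_scale:
  assumes "f \<in> lin_span X B" shows "(\<lambda>x. a * f x) \<in> lin_span X B"
proof -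
  obtain c where "\<forall>x\<in>X. f x = (\<Sum>b\<in>B. c b * b x)"
    using assms unfolding lin_span_def by blast
  then show ?thesis unfolding lin_span_def
    by (intro CollectI exI[of _ "\<lambda>b. a * c b"]) (simp add: sum_distrib_left mult.assoc)
qed

lemma lin_span_sum:
  "(\<And>i. i \<in> I \<Longrightarrow> f i \<in> lin_span X B) \<Longrightarrow> (\<lambda>x. \<Sum>i\<in>I. f i x) \<in> lin_span X B"
  by (induction I rule: infinite_finite_induct) (auto intro: lin_span_zero lin_span_add)

text \<open>The extra factor \<open>h\<close> lets one argument serve both products and, with h = 1,
  the passage to a larger spanning set.\<close>

lemma lin_span_induct:
  assumes f: "f \<in> lin_span X B" and base: "\<And>b. b \<in> B \<Longrightarrow> (\<lambda>x. b x * h x) \<in> lin_span X B'"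
  shows "(\<lambda>x. f x * h x) \<in> lin_span X B'"
proof -
  obtain c where c: "\<forall>x\<in>X. f x = (\<Sum>b\<in>B. c b * b x)"
    using f unfolding lin_span_def by blast
  have "(\<lambda>x. \<Sum>b\<in>B. c b * (b x * h x)) \<in> lin_span X B'"
    by (intro lin_span_sum lin_span_scale base)
  then show ?thesis
    by (rule lin_span_cong) (use c in \<open>simp add: sum_distrib_right mult.assoc\<close>)
qed

lemma lin_span_mult:
  assumes "f \<in> lin_span X B" "g \<in> lin_span X C"
    and bc: "\<And>b c. b \<in> B \<Longrightarrow> c \<in> C \<Longrightarrow> (\<lambda>x. b x * c x) \<in> lin_span X E"
  shows "(\<lambda>x. f x * g x) \<in> lin_span X E"
proof (rule lin_span_induct[OF assms(1)])
  fix b assume b: "b \<in> B"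
  have "(\<lambda>x. g x * b x) \<in> lin_span X E"
    by (rule lin_span_induct[OF assms(2)]) (use bc[OF b] in \<open>simp add: mult.commute\<close>)
  then show "(\<lambda>x. b x * g x) \<in> lin_span X E" by (simp add: mult.commute)
qed

lemma lin_span_mono:
  assumes "finite B'" "B \<subseteq> B'" "f \<in> lin_span X B" shows "f \<in> lin_span X B'"
  using lin_span_induct[OF assms(3), of "\<lambda>_. 1"] lin_span_base[OF assms(1)] assms(2) by fastforce

section \<open>Growth of polynomial algebras and their quadratic extensions\<close>

text \<open>Exponents are bounded one by one rather than in total, which makes the count a plain
  power. Monomials are functions, and different exponents may give the same one, so only upper
  bounds on their number are available.\<close>

definition monomials :: "('x \<Rightarrow> complex) set \<Rightarrow> nat \<Rightarrow> ('x \<Rightarrow> complex) set" where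
  "monomials W c = (\<lambda>\<beta> x. \<Prod>w\<in>W. w x ^ \<beta> w) ` PiE W (\<lambda>_. {..c})"

definition monomials_ext :: "('x \<Rightarrow> complex) set \<Rightarrow> ('x \<Rightarrow> complex) \<Rightarrow> nat \<Rightarrow> ('x \<Rightarrow> complex) set" where
  "monomials_ext W e c = monomials W c \<union> (\<lambda>f x. e x * f x) ` monomials W c"

lemma monomials_card:
  assumes "finite W"
  shows "finite (monomials W c)" "card (monomials W c) \<le> (c + 1) ^ card W"
proof -
  have fin: "finite (PiE W (\<lambda>_. {..c}))" using assms by (simp add: finite_PiE)
  then show "finite (monomials W c)" by (simp add: monomials_def)
  have "card (monomials W c) \<le> card (PiE W (\<lambda>_. {..c}))"
    unfolding monomials_def by (rule card_image_le[OF fin])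
  then show "card (monomials W c) \<le> (c + 1) ^ card W" using assms by (simp add: card_PiE)
qed

lemma monomials_ext_card:
  assumes "finite W"
  shows "finite (monomials_ext W e c)" "card (monomials_ext W e c) \<le> 2 * (c + 1) ^ card W"
proof -
  note fin = monomials_card[OF assms, of c]
  then show "finite (monomials_ext W e c)" by (simp add: monomials_ext_def)
  have "card (monomials_ext W e c) \<le> card (monomials W c) + card ((\<lambda>f x. e x * f x) ` monomials W c)"
    unfolding monomials_ext_def by (rule card_Un_le)
  also have "\<dots> \<le> card (monomials W c) + card (monomials W c)"
    by (intro add_left_mono card_image_le fin)
  finally show "card (monomials_ext W e c) \<le> 2 * (c + 1) ^ card W" using fin by simp
qed

lemma monomials_mono: "c \<le> c' \<Longrightarrow> monomials W c \<subseteq> monomials W c'"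
  unfolding monomials_def by (intro image_mono PiE_mono) auto

lemma monomials_ext_mono: "c \<le> c' \<Longrightarrow> monomials_ext W e c \<subseteq> monomials_ext W e c'"
  unfolding monomials_ext_def using monomials_mono[of c c' W] by blast

lemma monomials_mult:
  assumes "f \<in> monomials W c" "g \<in> monomials W c'"
  shows "(\<lambda>x. f x * g x) \<in> monomials W (c + c')"
proof -
  obtain \<beta> \<gamma> where b: "\<beta> \<in> PiE W (\<lambda>_. {..c})" "f = (\<lambda>x. \<Prod>w\<in>W. w x ^ \<beta> w)"
    and g: "\<gamma> \<in> PiE W (\<lambda>_. {..c'})" "g = (\<lambda>x. \<Prod>w\<in>W. w x ^ \<gamma> w)"
    using assms unfolding monomials_def by blast
  have "(\<lambda>x. f x * g x) = (\<lambda>x. \<Prod>w\<in>W. w x ^ (restrict (\<lambda>w. \<beta> w + \<gamma> w) W) w)"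
    unfolding b g by (rule ext) (simp add: prod.distrib[symmetric] power_add)
  moreover have "restrict (\<lambda>w. \<beta> w + \<gamma> w) W \<in> PiE W (\<lambda>_. {..c + c'})"
    using b(1) g(1) by (auto simp: PiE_iff add_mono)
  ultimately show ?thesis unfolding monomials_def by blast
qed

lemma monomials_one: "(\<lambda>x. 1) \<in> monomials W c"
proof -
  have "(\<lambda>x. 1) = (\<lambda>x. \<Prod>w\<in>W. w x ^ (restrict (\<lambda>_. 0) W) w)" by auto
  moreover have "restrict (\<lambda>_. 0::nat) W \<in> PiE W (\<lambda>_. {..c})" by auto
  ultimately show ?thesis unfolding monomials_def by blast
qed

lemma monomials_gen:
  assumes "finite W" "w \<in> W" shows "w \<in> monomials W 1"
proof -
  let ?b = "restrict (\<lambda>v. if v = w then 1 else 0 :: nat) W"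
  have "(\<Prod>v\<in>W. v x ^ ?b v) = w x" for x
  proof -
    have "(\<Prod>v\<in>W. v x ^ ?b v) = (\<Prod>v\<in>W. if v = w then v x else 1)" by (rule prod.cong) auto
    then show ?thesis using assms by simp
  qed
  then have "w = (\<lambda>x. \<Prod>v\<in>W. v x ^ ?b v)" by auto
  moreover have "?b \<in> PiE W (\<lambda>_. {..1})" by auto
  ultimately show ?thesis unfolding monomials_def by blast
qed

inductive_set gen_alg :: "('x \<Rightarrow> complex) set \<Rightarrow> ('x \<Rightarrow> complex) set" for G where
  const: "(\<lambda>x. c) \<in> gen_alg G"
| gen: "g \<in> G \<Longrightarrow> g \<in> gen_alg G"
| add: "f \<in> gen_alg G \<Longrightarrow> g \<in> gen_alg G \<Longrightarrow> (\<lambda>x. f x + g x) \<in> gen_alg G"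
| mult: "f \<in> gen_alg G \<Longrightarrow> g \<in> gen_alg G \<Longrightarrow> (\<lambda>x. f x * g x) \<in> gen_alg G"

lemma gen_alg_sum: "(\<And>i. i \<in> I \<Longrightarrow> f i \<in> gen_alg G) \<Longrightarrow> (\<lambda>x. \<Sum>i\<in>I. f i x) \<in> gen_alg G"
  by (induction I rule: infinite_finite_induct) (auto intro: gen_alg.intros)

lemma gen_alg_power: "f \<in> gen_alg G \<Longrightarrow> (\<lambda>x. f x ^ k) \<in> gen_alg G"
  by (induction k) (auto intro: gen_alg.intros)

lemma gen_alg_prod_list:
  "(\<And>t. t \<in> set ts \<Longrightarrow> f t \<in> gen_alg G) \<Longrightarrow> (\<lambda>x. prod_list (map (\<lambda>t. f t x) ts)) \<in> gen_alg G"
  by (induction ts) (auto intro: gen_alg.intros)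

lemma gen_alg_diff:
  assumes "f \<in> gen_alg G" "g \<in> gen_alg G" shows "(\<lambda>x. f x - g x) \<in> gen_alg G"
proof -
  have "(\<lambda>x. f x + (- 1) * g x) \<in> gen_alg G" by (intro gen_alg.intros assms)
  then show ?thesis by simp
qed

lemma gen_alg_span_monomials:
  assumes W: "finite W" and f: "f \<in> gen_alg W" shows "\<exists>c. f \<in> lin_span X (monomials W c)"
  using f
proof induction
  case (const a)
  have "(\<lambda>x. a * 1) \<in> lin_span X (monomials W 0)"
    by (intro lin_span_scale lin_span_base monomials_card monomials_one W)
  then show ?case by auto
next
  case (gen g)
  then show ?case using lin_span_base monomials_gen[OF W] monomials_card[OF W] by blast
next
  case (add f g)
  then obtain c c' where c: "f \<in> lin_span X (monomials W c)" "g \<in> lin_span X (monomials W c')" by blast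
  have "f \<in> lin_span X (monomials W (max c c'))" "g \<in> lin_span X (monomials W (max c c'))"
    using c lin_span_mono[OF monomials_card(1)[OF W] monomials_mono] by (meson max.cobounded1 max.cobounded2)+
  then show ?case using lin_span_add by blast
next
  case (mult f g)
  then obtain c c' where c: "f \<in> lin_span X (monomials W c)" "g \<in> lin_span X (monomials W c')" by blast
  have "(\<lambda>x. f x * g x) \<in> lin_span X (monomials W (c + c'))"
    by (rule lin_span_mult[OF c]) (intro lin_span_base monomials_card W monomials_mult)
  then show ?case by blast
qed

text \<open>Since the square of \<open>e\<close> is on \<open>X\<close> a polynomial in
  \<open>W\<close>, everything generated by \<open>e\<close> and \<open>W\<close> reduces to degree
  at most one in \<open>e\<close>. Adjoining \<open>e\<close> at most doubles the number of spanning
  functions and leaves the growth exponent \<open>card W\<close> unchanged.\<close>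

locale quadratic_extension =
  fixes X :: "'x set" and W :: "('x \<Rightarrow> complex) set" and e :: "'x \<Rightarrow> complex" and r :: nat
  assumes W: "finite W" and e: "(\<lambda>x. e x * e x) \<in> lin_span X (monomials W r)"
begin

abbreviation "ext_span c \<equiv> lin_span X (monomials_ext W e c)"

lemma ext_span_mono: "c \<le> c' \<Longrightarrow> f \<in> ext_span c \<Longrightarrow> f \<in> ext_span c'"
  using lin_span_mono[OF monomials_ext_card(1)[OF W] monomials_ext_mono] by blast

lemma ext_span_base: "f \<in> monomials_ext W e c \<Longrightarrow> f \<in> ext_span c"
  by (rule lin_span_base[OF monomials_ext_card(1)[OF W]])

text \<open>Exponent bounds add, except in the product of two terms containing \<open>e\<close>:
  there \<open>e * e\<close> is replaced by monomials with exponents up to \<open>r\<close>, which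
  is the additional \<open>r\<close>.\<close>

lemma ext_span_mult:
  assumes "f \<in> ext_span c" "g \<in> ext_span c'" shows "(\<lambda>x. f x * g x) \<in> ext_span (c + c' + r)"
proof (rule lin_span_mult[OF assms])
  fix a b assume a: "a \<in> monomials_ext W e c" and b: "b \<in> monomials_ext W e c'"
  have plain: "(\<lambda>x. f x * g x) \<in> ext_span (c + c' + r)"
    if "f \<in> monomials W c" "g \<in> monomials W c'" for f g
    using monomials_mult[OF that] monomials_mono[of "c + c'" "c + c' + r" W]
    by (intro ext_span_base) (auto simp: monomials_ext_def)
  have one: "(\<lambda>x. e x * (f x * g x)) \<in> ext_span (c + c' + r)"
    if "f \<in> monomials W c" "g \<in> monomials W c'" for f g
    using monomials_mult[OF that] monomials_mono[of "c + c'" "c + c' + r" W]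
    by (intro ext_span_base) (auto simp: monomials_ext_def)
  have two: "(\<lambda>x. e x * e x * (f x * g x)) \<in> ext_span (c + c' + r)"
    if fg: "f \<in> monomials W c" "g \<in> monomials W c'" for f g
  proof (rule lin_span_induct[OF e])
    fix h assume "h \<in> monomials W r"
    from monomials_mult[OF this monomials_mult[OF fg]]
    have "(\<lambda>x. h x * (f x * g x)) \<in> monomials W (c + c' + r)" by (simp add: add.commute add.left_commute)
    then show "(\<lambda>x. h x * (f x * g x)) \<in> ext_span (c + c' + r)"
      by (intro ext_span_base) (simp add: monomials_ext_def)
  qed
  from a b consider "a \<in> monomials W c" "b \<in> monomials W c'"
    | f where "f \<in> monomials W c" "a = (\<lambda>x. e x * f x)" "b \<in> monomials W c'"
    | g where "a \<in> monomials W c" "g \<in> monomials W c'" "b = (\<lambda>x. e x * g x)"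
    | f g where "f \<in> monomials W c" "a = (\<lambda>x. e x * f x)" "g \<in> monomials W c'" "b = (\<lambda>x. e x * g x)"
    unfolding monomials_ext_def by blast
  then show "(\<lambda>x. a x * b x) \<in> ext_span (c + c' + r)"
  proof cases
    case 1 then show ?thesis by (rule plain)
  next
    case 2 then show ?thesis using one[of f b] by (simp add: mult.assoc)
  next
    case 3 then show ?thesis using one[of a g] by (simp add: mult.left_commute)
  next
    case 4 then show ?thesis using two[of f g] by (simp add: mult.assoc mult.left_commute)
  qed
qed

lemma ext_span_one: "(\<lambda>x. 1) \<in> ext_span c"
  using monomials_one by (intro ext_span_base) (auto simp: monomials_ext_def)

lemma gen_alg_ext_span:
  assumes "f \<in> gen_alg (insert e W)" shows "\<exists>c. f \<in> ext_span c"
  using assms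
proof induction
  case (const a)
  show ?case using lin_span_scale[OF ext_span_one, of a] by auto
next
  case (gen g)
  have "e \<in> monomials_ext W e 0"
    using monomials_one[of W 0] unfolding monomials_ext_def by (auto intro!: image_eqI[of _ _ "\<lambda>_. 1"])
  moreover have "g \<in> monomials_ext W e 1" if "g \<in> W"
    using monomials_gen[OF W that] by (simp add: monomials_ext_def)
  ultimately show ?case using gen ext_span_base by blast
next
  case (add f g)
  then obtain c c' where "f \<in> ext_span c" "g \<in> ext_span c'" by blast
  then have "f \<in> ext_span (max c c')" "g \<in> ext_span (max c c')"
    by (auto intro: ext_span_mono[rotated])
  then show ?case using lin_span_add by blast
next
  case (mult f g)
  then show ?case using ext_span_mult by blast
qed

lemma ext_span_power:
  assumes "f \<in> ext_span c" shows "(\<lambda>x. f x ^ k) \<in> ext_span (k * (c + r))"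
proof (induction k)
  case 0 show ?case using ext_span_one by simp
next
  case (Suc k)
  from ext_span_mult[OF assms Suc] show ?case by (simp add: algebra_simps)
qed

lemma ext_span_prod:
  assumes "finite I" "\<And>i. i \<in> I \<Longrightarrow> f i \<in> ext_span c"
  shows "(\<lambda>x. \<Prod>i\<in>I. f i x) \<in> ext_span (card I * (c + r))"
  using assms
proof (induction I rule: finite_induct)
  case empty show ?case using ext_span_one by simp
next
  case (insert i I)
  from ext_span_mult[OF insert.prems[of i] insert.IH] insert.prems insert.hyps
  show ?case by (simp add: algebra_simps)
qed

text \<open>Dimension count: there are \<open>E ^ N\<close> monomials in the \<open>t i\<close> with exponents below \<open>E\<close>, enumerated
  by the base-\<open>E\<close> digits of \<open>k\<close>, but cleared of denominators they lie in a space of dimension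
  \<open>O(E ^ card W)\<close>.\<close>

lemma algebraic_dependence:
  fixes t :: "nat \<Rightarrow> 'x \<Rightarrow> complex"
  assumes card: "card W < N"
    and \<delta>: "\<delta> \<in> gen_alg (insert e W)"
    and t: "\<And>i. i < N \<Longrightarrow> \<exists>g\<in>gen_alg (insert e W). \<forall>x\<in>X. \<delta> x * t i x = g x"
  shows "\<exists>E c. (\<exists>k<E^N. c k \<noteq> 0) \<and>
    (\<forall>x\<in>X. \<delta> x \<noteq> 0 \<longrightarrow> (\<Sum>k<E^N. c k * (\<Prod>i<N. t i x ^ (k div E ^ i mod E))) = 0)"
proof -
  have "\<exists>c. (\<lambda>x. \<delta> x * t i x) \<in> ext_span c" if "i < N" for i
  proof -
    obtain g where g: "g \<in> gen_alg (insert e W)" "\<And>x. x \<in> X \<Longrightarrow> \<delta> x * t i x = g x"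
      using t[OF \<open>i < N\<close>] by blast
    obtain c where "g \<in> ext_span c" using gen_alg_ext_span[OF g(1)] by blast
    then have "(\<lambda>x. \<delta> x * t i x) \<in> ext_span c" by (rule lin_span_cong) (rule g(2))
    then show ?thesis by blast
  qed
  then obtain c where c: "\<And>i. i < N \<Longrightarrow> (\<lambda>x. \<delta> x * t i x) \<in> ext_span (c i)" by metis
  obtain c0 where c0: "\<delta> \<in> ext_span c0" using gen_alg_ext_span[OF \<delta>] by blast
  define C where "C = c0 + (\<Sum>i<N. c i)"
  have \<delta>C: "\<delta> \<in> ext_span C" by (rule ext_span_mono[OF _ c0]) (simp add: C_def)
  have tC: "(\<lambda>x. \<delta> x * t i x) \<in> ext_span C" if "i < N" for i
  proof (rule ext_span_mono[OF _ c[OF that]])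
    have "c i \<le> (\<Sum>i<N. c i)" using that by (intro member_le_sum) auto
    then show "c i \<le> C" by (simp add: C_def)
  qed
  \<comment> \<open>Growth of the exponent bound per unit of \<open>E\<close>. One \<open>r\<close>
    pays for the multiplications within powers, one for joining the two powers in each factor of
    \<open>F\<close>, one for the product over \<open>i\<close>.\<close>
  define K where "K = N * (C + r + r + r)"
  define m where "m = card W"
  \<comment> \<open>Chosen to exceed the constant in 2 (K E + 1)^m <= 2 (K + 1)^m E^m, so that a
    single further power of \<open>E\<close> outweighs it; \<open>K\<close> does not depend on
    \<open>E\<close>.\<close>
  define E where "E = 2 * (K + 1) ^ m + 1"
  have E1: "E \<ge> 1" by (simp add: E_def)
  define B where "B = monomials_ext W e (K * E)"
  \<comment> \<open>Each factor is padded to exactly \<open>E\<close> powers of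
    \<open>\<delta>\<close>, so that all \<open>F k\<close> carry the same denominator power
    \<open>\<delta> ^ (E * N)\<close>, which cancels at the end.\<close>
  define F where "F k x = (\<Prod>i<N. \<delta> x ^ (E - k div E ^ i mod E) * (\<delta> x * t i x) ^ (k div E ^ i mod E))" for k x
  have FB: "F k \<in> lin_span X B" for k
  proof -
    have "(\<lambda>x. \<delta> x ^ (E - k div E ^ i mod E) * (\<delta> x * t i x) ^ (k div E ^ i mod E))
        \<in> ext_span (E * (C + r) + r)" if "i < N" for i
    proof -
      have "k div E ^ i mod E \<le> E" using E1 by (simp add: less_imp_le)
      then have "(E - k div E ^ i mod E) * (C + r) + (k div E ^ i mod E) * (C + r) = E * (C + r)"
        by (simp add: add_mult_distrib[symmetric])
      then show ?thesis using ext_span_mult[OF ext_span_power[OF \<delta>C] ext_span_power[OF tC[OF that]]] by metis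
    qed
    then have "F k \<in> ext_span (card {..<N} * (E * (C + r) + r + r))"
      unfolding F_def[abs_def] by (intro ext_span_prod) auto
    moreover have "card {..<N} * (E * (C + r) + r + r) \<le> K * E"
    proof -
      have "r \<le> E * r" using E1 by simp
      then have "E * (C + r) + r + r \<le> (C + r + r + r) * E"
        unfolding add_mult_distrib add_mult_distrib2 mult.commute[of _ E] by linarith
      then show ?thesis by (simp add: K_def mult.assoc)
    qed
    ultimately show ?thesis unfolding B_def using ext_span_mono by blast
  qed
  then have "\<forall>k. \<exists>c. \<forall>x\<in>X. F k x = (\<Sum>b\<in>B. c b * b x)" unfolding lin_span_def by blast
  from choice[OF this] obtain M where M: "\<And>k x. x \<in> X \<Longrightarrow> F k x = (\<Sum>b\<in>B. M k b * b x)" by blast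
  have "card B \<le> 2 * (K * E + 1) ^ m" unfolding B_def m_def by (rule monomials_ext_card(2)[OF W])
  also have "\<dots> \<le> 2 * ((K + 1) * E) ^ m" using E1 by (intro mult_left_mono power_mono) auto
  also have "\<dots> = (2 * (K + 1) ^ m) * E ^ m" by (simp only: power_mult_distrib mult.assoc)
  also have "\<dots> < E * E ^ m"
  proof (rule mult_strict_right_mono)
    show "2 * (K + 1) ^ m < E" by (simp add: E_def)
    show "0 < E ^ m" using E1 by simp
  qed
  also have "\<dots> \<le> E ^ N" using card E1 power_increasing[of "Suc m" N E] by (simp add: m_def)
  finally have "card B < card {..<E ^ N}" by simp
  then obtain a k where k: "k < E ^ N" "a k \<noteq> 0"
    and a: "\<And>b. b \<in> B \<Longrightarrow> (\<Sum>k<E ^ N. a k * M k b) = 0"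
    using nontrivial_kernel_exists[of B "{..<E ^ N}" M] monomials_ext_card(1)[OF W] by (auto simp: B_def)
  have "(\<Sum>k<E^N. a k * (\<Prod>i<N. t i x ^ (k div E ^ i mod E))) = 0" if x: "x \<in> X" "\<delta> x \<noteq> 0" for x
  proof -
    have F: "F k x = \<delta> x ^ (E * N) * (\<Prod>i<N. t i x ^ (k div E ^ i mod E))" for k
    proof -
      have "\<delta> x ^ (E - k div E ^ i mod E) * (\<delta> x * t i x) ^ (k div E ^ i mod E) =
          \<delta> x ^ E * t i x ^ (k div E ^ i mod E)" for i
      proof -
        have "k div E ^ i mod E \<le> E" using E1 by (simp add: less_imp_le)
        then have "\<delta> x ^ E = \<delta> x ^ (E - k div E ^ i mod E) * \<delta> x ^ (k div E ^ i mod E)"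
          by (simp flip: power_add)
        then show ?thesis by (simp add: power_mult_distrib)
      qed
      then show ?thesis unfolding F_def by (simp add: prod.distrib power_mult)
    qed
    have "\<delta> x ^ (E * N) * (\<Sum>k<E^N. a k * (\<Prod>i<N. t i x ^ (k div E ^ i mod E))) = (\<Sum>k<E^N. a k * F k x)"
      by (simp add: F sum_distrib_left mult.left_commute)
    also have "\<dots> = (\<Sum>k<E^N. \<Sum>b\<in>B. a k * M k b * b x)"
      by (simp add: M[OF x(1)] sum_distrib_left mult.assoc)
    also have "\<dots> = (\<Sum>b\<in>B. (\<Sum>k<E^N. a k * M k b) * b x)"
      by (subst sum.swap) (simp add: sum_distrib_right)
    also have "\<dots> = 0" using a by simp
    finally show ?thesis using x(2) by simp
  qed
  then show ?thesis using k by blast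
qed

end

lemma sum_digits: "k < E ^ N \<Longrightarrow> (\<Sum>i<N. (k div E ^ i mod E) * E ^ i) = (k::nat)"
proof (induction N arbitrary: k)
  case (Suc N)
  have E: "E > 0" using Suc.prems by (cases "E = 0") auto
  have "(\<Sum>i<Suc N. (k div E ^ i mod E) * E ^ i) = k mod E + E * (\<Sum>i<N. (k div E div E ^ i mod E) * E ^ i)"
    by (subst sum.lessThan_Suc_shift) (simp add: sum_distrib_left div_mult2_eq mult.left_commute)
  also have "(\<Sum>i<N. (k div E div E ^ i mod E) * E ^ i) = k div E"
    using Suc.prems by (intro Suc.IH) (simp add: less_mult_imp_div_less mult.commute)
  finally show ?case by simp
qed simp

text \<open>Kronecker substitution: giving the \<open>i\<close>-th coordinate the value \<open>s ^ (E ^ i)\<close> turns the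
  \<open>k\<close>-th monomial into \<open>s ^ k\<close>.\<close>

lemma digit_polynomial_nonzero:
  fixes c :: "nat \<Rightarrow> complex"
  assumes h: "bij_betw h (msets_of_degree n d) {..<N}" and k: "k < E ^ N" "c k \<noteq> 0"
  shows "\<exists>T\<in>sym_tensors n d. \<forall>rep. (\<forall>i<N. rep i \<in> tindices n d \<and> h (mset (rep i)) = i) \<longrightarrow>
    (\<Sum>k<E ^ N. c k * (\<Prod>i<N. T (rep i) ^ (k div E ^ i mod E))) \<noteq> 0"
proof -
  define q where "q = (\<Sum>k<E^N. monom (c k) k)"
  have "coeff q k = c k" using k by (simp add: q_def coeff_sum)
  then have "q \<noteq> 0" using k by auto
  then obtain s where s: "poly q s \<noteq> 0" using poly_all_0_iff_0 by blast
  define T where "T ix = (if ix \<in> tindices n d then s ^ (E ^ h (mset ix)) else 0)" for ix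
  have "T \<in> sym_tensors n d" by (simp add: sym_tensors_def T_def)
  moreover have "(\<Sum>k<E ^ N. c k * (\<Prod>i<N. T (rep i) ^ (k div E ^ i mod E))) = poly q s"
    if rep: "\<forall>i<N. rep i \<in> tindices n d \<and> h (mset (rep i)) = i" for rep
  proof -
    have "(\<Prod>i<N. T (rep i) ^ (k div E ^ i mod E)) = s ^ k" if "k < E ^ N" for k
    proof -
      have "(\<Prod>i<N. T (rep i) ^ (k div E ^ i mod E)) = (\<Prod>i<N. s ^ ((k div E ^ i mod E) * E ^ i))"
        by (rule prod.cong) (use rep in \<open>auto simp: T_def power_mult[symmetric] mult.commute\<close>)
      also have "\<dots> = s ^ (\<Sum>i<N. (k div E ^ i mod E) * E ^ i)" by (simp add: power_sum)
      finally show ?thesis using sum_digits[OF that] by simp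
    qed
    then show ?thesis by (simp add: q_def poly_sum poly_monom)
  qed
  ultimately show ?thesis using s by (intro bexI[of _ T]) auto
qed

subsection \<open>Pairs of independent eigenvectors of equal length\<close>

lemma sum_tindices_Suc:
  "(\<Sum>ix\<in>tindices n (Suc d). f ix) = (\<Sum>i<n. \<Sum>ix\<in>tindices n d. f (i # ix))"
proof -
  have eq: "tindices n (Suc d) = (\<lambda>(i, ix). i # ix) ` ({..<n} \<times> tindices n d)"
    by (auto simp: tindices_def length_Suc_conv image_iff)
  have "inj_on (\<lambda>(i, ix). i # ix) ({..<n} \<times> tindices n d)" by (auto simp: inj_on_def)
  then show ?thesis
    unfolding eq by (simp add: sum.reindex sum.cartesian_product split_def comp_def)
qed

text \<open>Distributivity: an index list picks one summand from each factor. It makes sums over the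
  inner index lists of two composed base changes factor into entries of a matrix product.\<close>

lemma sum_prod_list_tindices:
  fixes f :: "'a \<Rightarrow> nat \<Rightarrow> 'b::comm_semiring_1"
  shows "(\<Sum>jx\<in>tindices n (length xs). prod_list (map2 f xs jx)) = prod_list (map (\<lambda>x. \<Sum>j<n. f x j) xs)"
proof (induction xs)
  case Nil
  have "tindices n 0 = {[]}" by (auto simp: tindices_def)
  then show ?case by simp
next
  case (Cons x xs)
  then show ?case
    by (simp add: sum_tindices_Suc sum_distrib_left[symmetric] sum_distrib_right[symmetric])
qed

text \<open>The identity matrix with columns \<open>a\<close> and \<open>b\<close> replaced by
  \<open>u\<close> and \<open>v\<close>; its determinant is \<open>minor a b u v\<close>.\<close>

definition basis_change :: "nat \<Rightarrow> nat \<Rightarrow> (nat \<Rightarrow> complex) \<Rightarrow> (nat \<Rightarrow> complex) \<Rightarrow> nat \<Rightarrow> nat \<Rightarrow> complex" where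
  "basis_change a b u v i j = (if j = a then u i else if j = b then v i else if i = j then 1 else 0)"

definition minor :: "nat \<Rightarrow> nat \<Rightarrow> (nat \<Rightarrow> complex) \<Rightarrow> (nat \<Rightarrow> complex) \<Rightarrow> complex" where
  "minor a b u v = u a * v b - u b * v a"

text \<open>The adjugate of \<open>basis_change\<close>, with \<open>p\<close> and \<open>q\<close>
  its rows \<open>a\<close> and \<open>b\<close>. Using it instead of the inverse keeps all entries
  polynomial in \<open>u\<close> and \<open>v\<close>.\<close>

definition basis_cochange :: "nat \<Rightarrow> nat \<Rightarrow> (nat \<Rightarrow> complex) \<Rightarrow> (nat \<Rightarrow> complex) \<Rightarrow> nat \<Rightarrow> nat \<Rightarrow> complex" where
  "basis_cochange a b u v j l =
    (let p = (if l = a then v b else 0) - (if l = b then v a else 0);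
         q = (if l = b then u a else 0) - (if l = a then u b else 0)
     in if j = a then p else if j = b then q
        else (if j = l then minor a b u v else 0) - u j * p - v j * q)"

lemma basis_change_cochange:
  assumes ab: "a < n" "b < n" "a \<noteq> b" and i: "i < n"
  shows "(\<Sum>j<n. basis_change a b u v i j * basis_cochange a b u v j l) = (if i = l then minor a b u v else 0)"
proof -
  let ?f = "\<lambda>j. basis_change a b u v i j * basis_cochange a b u v j l"
  let ?R = "{..<n} - {a} - {b}"
  have "(\<Sum>j<n. ?f j) = ?f a + ?f b + sum ?f ?R"
    using ab by (subst sum.remove[of _ a], simp, simp, subst sum.remove[of _ b]) auto
  also have "sum ?f ?R = (\<Sum>j\<in>?R. if j = i then basis_cochange a b u v i l else 0)"
    by (rule sum.cong) (auto simp: basis_change_def)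
  also have "\<dots> = (if i \<noteq> a \<and> i \<noteq> b then basis_cochange a b u v i l else 0)"
    using i by (subst sum.delta) auto
  also have "?f a + ?f b + (if i \<noteq> a \<and> i \<noteq> b then basis_cochange a b u v i l else 0) =
      (if i = l then minor a b u v else 0)"
    using ab by (auto simp: basis_change_def basis_cochange_def minor_def Let_def algebra_simps)
  finally show ?thesis .
qed

definition transform :: "nat \<Rightarrow> nat \<Rightarrow> nat \<Rightarrow> nat \<Rightarrow> (nat list \<Rightarrow> complex) \<Rightarrow> (nat \<Rightarrow> complex) \<Rightarrow>
    (nat \<Rightarrow> complex) \<Rightarrow> nat list \<Rightarrow> complex" where
  "transform n d a b T u v jx = (\<Sum>ix\<in>tindices n d. T ix * prod_list (map2 (basis_change a b u v) ix jx))"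

lemma prod_list_map2_mult:
  fixes g :: "'a \<Rightarrow> 'b \<Rightarrow> 'c::comm_monoid_mult"
  assumes "length ix = length jx" "length jx = length lx"
  shows "prod_list (map2 g ix jx) * prod_list (map2 h jx lx) =
    prod_list (map2 (\<lambda>(i, l) j. g i j * h j l) (zip ix lx) jx)"
  using assms by (induction ix jx lx rule: list_induct3) (auto simp: ac_simps)

lemma prod_list_delta:
  fixes D :: "'b::comm_semiring_1"
  assumes "length ix = length lx"
  shows "prod_list (map (\<lambda>(i, l). if i = l then D else 0) (zip ix lx)) = (if ix = lx then D ^ length lx else 0)"
  using assms by (induction ix lx rule: list_induct2) auto

text \<open>In each of the \<open>d\<close> tensor factors the matrix and its adjugate compose to
  the determinant times the identity, whence the power of the minor.\<close>

lemma transform_inverse: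
  assumes ab: "a < n" "b < n" "a \<noteq> b" and lx: "lx \<in> tindices n d"
  shows "(\<Sum>jx\<in>tindices n d. transform n d a b T u v jx * prod_list (map2 (basis_cochange a b u v) jx lx)) =
    minor a b u v ^ d * T lx"
proof -
  let ?g = "basis_change a b u v" and ?h = "basis_cochange a b u v"
  have "(\<Sum>jx\<in>tindices n d. transform n d a b T u v jx * prod_list (map2 ?h jx lx)) =
      (\<Sum>jx\<in>tindices n d. \<Sum>ix\<in>tindices n d. T ix * (prod_list (map2 ?g ix jx) * prod_list (map2 ?h jx lx)))"
    unfolding transform_def sum_distrib_right by (simp add: mult.assoc)
  also have "\<dots> = (\<Sum>ix\<in>tindices n d. T ix *
      (\<Sum>jx\<in>tindices n d. prod_list (map2 ?g ix jx) * prod_list (map2 ?h jx lx)))"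
    unfolding sum_distrib_left by (rule sum.swap)
  also have "\<dots> = (\<Sum>ix\<in>tindices n d. T ix * (if ix = lx then minor a b u v ^ d else 0))"
  proof (intro sum.cong refl arg_cong2[of _ _ _ _ "(*)"])
    fix ix assume ix: "ix \<in> tindices n d"
    then have len: "length (zip ix lx) = d" "length ix = length lx" "length lx = d"
      using lx by (auto simp: tindices_def)
    have "(\<Sum>jx\<in>tindices n d. prod_list (map2 ?g ix jx) * prod_list (map2 ?h jx lx)) =
        (\<Sum>jx\<in>tindices n (length (zip ix lx)). prod_list (map2 (\<lambda>(i, l) j. ?g i j * ?h j l) (zip ix lx) jx))"
      unfolding len(1) by (intro sum.cong refl prod_list_map2_mult) (use ix lx in \<open>auto simp: tindices_def\<close>)
    also have "\<dots> = prod_list (map (\<lambda>x. \<Sum>j<n. (\<lambda>(i, l) j. ?g i j * ?h j l) x j) (zip ix lx))"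
      by (rule sum_prod_list_tindices)
    also have "map (\<lambda>x. \<Sum>j<n. (\<lambda>(i, l) j. ?g i j * ?h j l) x j) (zip ix lx) =
        map (\<lambda>(i, l). if i = l then minor a b u v else 0) (zip ix lx)"
    proof (intro map_cong refl)
      fix x assume "x \<in> set (zip ix lx)"
      then have "fst x < n" using ix set_zip_leftD[of "fst x" "snd x" ix lx] by (auto simp: tindices_def)
      then show "(\<Sum>j<n. (\<lambda>(i, l) j. ?g i j * ?h j l) x j) = (\<lambda>(i, l). if i = l then minor a b u v else 0) x"
        using basis_change_cochange[OF ab, of "fst x" u v "snd x"] by (simp add: split_def)
    qed
    also have "prod_list \<dots> = (if ix = lx then minor a b u v ^ d else 0)"
      using prod_list_delta[OF len(2), of "minor a b u v"] len(3) by simp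
    finally show "(\<Sum>jx\<in>tindices n d. prod_list (map2 ?g ix jx) * prod_list (map2 ?h jx lx)) =
        (if ix = lx then minor a b u v ^ d else 0)" .
  qed
  also have "\<dots> = (\<Sum>ix\<in>tindices n d. if ix = lx then T ix * minor a b u v ^ d else 0)"
    by (rule sum.cong) auto
  also have "\<dots> = minor a b u v ^ d * T lx" using lx by simp
  finally show ?thesis .
qed

text \<open>Permuting the new indices amounts to permuting the summation indices by the inverse,
  which the symmetric \<open>T\<close> does not notice.\<close>

lemma transform_sym:
  assumes T: "T \<in> sym_tensors n d" and jx: "jx \<in> tindices n d" and eq: "mset jx = mset jy"
  shows "transform n d a b T u v jy = transform n d a b T u v jx"
proof -
  let ?g = "basis_change a b u v"
  obtain p where p: "p permutes {..<length jx}" "permute_list p jx = jy"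
    using mset_eq_permutation[OF eq[symmetric]] by blast
  have len: "length jx = d" using jx by (simp add: tindices_def)
  have pd: "p permutes {..<d}" "inv p permutes {..<d}" using p len permutes_inv by auto
  have tind: "permute_list q ix \<in> tindices n d" if "q permutes {..<d}" "ix \<in> tindices n d" for q ix
    using that by (auto simp: tindices_def)
  show ?thesis unfolding transform_def
  proof (rule sum.reindex_bij_witness[of _ "permute_list p" "permute_list (inv p)"])
    fix ix assume ix: "ix \<in> tindices n d"
    then have l: "length ix = d" by (simp add: tindices_def)
    show i1: "permute_list p (permute_list (inv p) ix) = ix"
      using pd l permutes_inv_o[OF pd(1)] by (simp flip: permute_list_compose)
    show i2: "permute_list (inv p) (permute_list p ix) = ix"
      using pd l permutes_inv_o[OF pd(1)] by (simp flip: permute_list_compose)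
    show "permute_list (inv p) ix \<in> tindices n d" "permute_list p ix \<in> tindices n d"
      using tind pd ix by auto
    have "T (permute_list (inv p) ix) = T ix"
    proof -
      have "mset (permute_list (inv p) ix) = mset ix" using pd(2) l by simp
      moreover have "\<forall>ix\<in>tindices n d. \<forall>jx\<in>tindices n d. mset ix = mset jx \<longrightarrow> T ix = T jx"
        using T unfolding sym_tensors_def by blast
      ultimately show ?thesis using ix tind[OF pd(2) ix] by blast
    qed
    moreover have "prod_list (map2 ?g (permute_list (inv p) ix) jx) = prod_list (map2 ?g ix jy)"
    proof -
      let ?ix = "permute_list (inv p) ix"
      have l': "length ?ix = d" using l by simp
      have "map2 ?g ix jy = map2 ?g (permute_list p ?ix) (permute_list p jx)"
        using i1 p by simp
      also have "\<dots> = permute_list p (map2 ?g ?ix jx)"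
        using pd(1) l' len by (simp add: permute_list_zip[of p "{..<d}"] permute_list_map)
      finally have "mset (map2 ?g ix jy) = mset (map2 ?g ?ix jx)"
        using pd(1) l' len mset_permute_list[of p "map2 ?g ?ix jx"] by simp
      then show ?thesis by (metis prod_mset_prod_list)
    qed
    ultimately show "T (permute_list (inv p) ix) * prod_list (map2 ?g (permute_list (inv p) ix) jx) =
        T ix * prod_list (map2 ?g ix jy)" by simp
  qed
qed

text \<open>Column \<open>c\<close> of the base change is \<open>w\<close>, so this entry feeds
  \<open>D\<close> copies of \<open>w\<close> and one column \<open>j\<close> into \<open>T\<close>.
  An eigenvector equation for \<open>w\<close> therefore determines it.\<close>

lemma transform_special:
  assumes T: "T \<in> sym_tensors n (Suc D)" and jx: "jx \<in> tindices n (Suc D)"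
    and eq: "mset jx = add_mset j (replicate_mset D c)"
    and w: "\<And>i. basis_change a b u v i c = w i"
  shows "transform n (Suc D) a b T u v jx = (\<Sum>i<n. basis_change a b u v i j * ccontract n D T w i)"
proof -
  let ?g = "basis_change a b u v"
  have "transform n (Suc D) a b T u v jx = transform n (Suc D) a b T u v (j # replicate D c)"
    by (rule transform_sym[OF T jx, symmetric]) (simp add: eq)
  also have "\<dots> = (\<Sum>i<n. ?g i j * ccontract n D T w i)"
    unfolding transform_def sum_tindices_Suc ccontract_def sum_distrib_left
  proof (intro sum.cong refl)
    fix i ix assume "ix \<in> tindices n D"
    then have l: "length ix = D" by (simp add: tindices_def)
    have "map2 ?g ix (replicate D c) = map w ix"
      unfolding l[symmetric] using w by (induction ix) auto
    then show "T (i # ix) * prod_list (map2 ?g (i # ix) (j # replicate D c)) =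
        ?g i j * (T (i # ix) * prod_list (map w ix))" by (simp add: ac_simps)
  qed
  finally show ?thesis .
qed

section \<open>Parameter count for pairs of eigenvectors\<close>

definition special_msets :: "nat \<Rightarrow> nat \<Rightarrow> nat \<Rightarrow> nat multiset set" where
  "special_msets n D c = (\<lambda>j. add_mset j (replicate_mset D c)) ` {..<n}"

text \<open>The two families are disjoint because \<open>a\<close> occurs at least \<open>D\<close>
  times in a member of the first and at most once in a member of the second. This is where d >= 3
  enters the parameter count.\<close>

lemma special_msets_card:
  assumes D: "D \<ge> 2" and ab: "a < n" "b < n" "a \<noteq> b"
  shows "special_msets n D a \<union> special_msets n D b \<subseteq> msets_of_degree n (Suc D)"
    "card (special_msets n D a \<union> special_msets n D b) = 2 * n"
proof -
  show "special_msets n D a \<union> special_msets n D b \<subseteq> msets_of_degree n (Suc D)"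
    using ab by (auto simp: special_msets_def msets_of_degree_iff split: if_splits)
  have card: "card (special_msets n D c) = n" for c
    unfolding special_msets_def by (subst card_image) (auto simp: inj_on_def)
  have "special_msets n D a \<inter> special_msets n D b = {}"
  proof (rule ccontr)
    assume "special_msets n D a \<inter> special_msets n D b \<noteq> {}"
    then obtain i j where eq: "add_mset i (replicate_mset D a) = add_mset j (replicate_mset D b)"
      unfolding special_msets_def by blast
    have "count (add_mset i (replicate_mset D a)) a \<ge> D" by simp
    moreover have "count (add_mset j (replicate_mset D b)) a \<le> 1" using ab by simp
    ultimately show False using eq D by simp
  qed
  moreover have "finite (special_msets n D c)" for c by (simp add: special_msets_def)
  ultimately show "card (special_msets n D a \<union> special_msets n D b) = 2 * n"
    by (simp add: card_Un_disjoint card)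
qed

text \<open>A configuration \<open>(T, u, v)\<close> with \<open>u\<close>, \<open>v\<close> independent is determined by \<open>u\<close>, \<open>v\<close> and the entries
  of \<open>T\<close> in a basis extending \<open>u\<close>, \<open>v\<close>; the eigenvector equations fix \<open>2 * n\<close> of these entries, and
  the relation between the norms removes one more parameter (the coordinate \<open>u 0\<close> becomes quadratic over
  the others).\<close>

lemma generic_no_pair:
  fixes n D a b :: nat and \<epsilon> :: complex
  assumes D: "D \<ge> 2" and ab: "a < n" "b < n" "a \<noteq> b"
  shows "\<exists>p\<in>poly_fun. (\<exists>T\<in>sym_tensors n (Suc D). p T \<noteq> 0) \<and>
    (\<forall>T\<in>sym_tensors n (Suc D). \<forall>u v.
      (\<forall>i<n. ccontract n D T u i = u i) \<longrightarrow> (\<forall>i<n. ccontract n D T v i = \<epsilon> * v i) \<longrightarrow>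
      (\<Sum>i<n. u i * u i) = (\<Sum>i<n. v i * v i) \<longrightarrow> minor a b u v \<noteq> 0 \<longrightarrow> p T = 0)"
proof -
  define Mon where "Mon = msets_of_degree n (Suc D)"
  define Sp where "Sp = special_msets n D a \<union> special_msets n D b"
  define N where "N = card Mon"
  obtain h where h: "bij_betw h Mon {..<N}"
    unfolding N_def Mon_def using ex_bij_betw_finite_nat[OF finite_msets_of_degree] by (auto simp: atLeast0LessThan)
  define rep where "rep i = sorted_list_of_multiset (inv_into Mon h i)" for i
  have rep: "rep i \<in> tindices n (Suc D) \<and> h (mset (rep i)) = i" if "i < N" for i
  proof -
    have "inv_into Mon h i \<in> Mon" "h (inv_into Mon h i) = i"
      using h that by (auto simp: bij_betw_def inv_into_into f_inv_into_f)
    then show ?thesis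
      by (auto simp: rep_def Mon_def msets_of_degree_iff tindices_def simp flip: size_mset)
  qed
  define X :: "((nat list \<Rightarrow> complex) \<times> (nat \<Rightarrow> complex) \<times> (nat \<Rightarrow> complex)) set" where
    "X = {(T, u, v). T \<in> sym_tensors n (Suc D) \<and> (\<forall>i<n. ccontract n D T u i = u i) \<and>
      (\<forall>i<n. ccontract n D T v i = \<epsilon> * v i) \<and> (\<Sum>i<n. u i * u i) = (\<Sum>i<n. v i * v i)}"
  define U where "U i = (\<lambda>(T :: nat list \<Rightarrow> complex, u :: nat \<Rightarrow> complex, v :: nat \<Rightarrow> complex). u i)" for i
  define V where "V i = (\<lambda>(T :: nat list \<Rightarrow> complex, u :: nat \<Rightarrow> complex, v :: nat \<Rightarrow> complex). v i)" for i
  define Q where "Q B = (\<lambda>(T, u, v). transform n (Suc D) a b T u v (sorted_list_of_multiset B))" for B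
  \<comment> \<open>\<open>U 0\<close> is left out, as it is the quadratic element adjoined
    afterwards. The entries \<open>Q\<close> are those of the transformed tensor that the
    eigenvector equations do not prescribe, one per multiset of indices.\<close>
  define W where "W = U ` {1..<n} \<union> V ` {..<n} \<union> Q ` (Mon - Sp)"
  let ?A = "gen_alg (insert (U 0) W)"
  have finMon: "finite Mon" by (simp add: Mon_def)
  have finW: "finite W" using finMon by (simp add: W_def)
  have Sp: "Sp \<subseteq> Mon" "card Sp = 2 * n"
    using special_msets_card[OF D ab] by (simp_all add: Sp_def Mon_def)
  have cardW: "card W < N"
  proof -
    have "card W \<le> card (U ` {1..<n}) + card (V ` {..<n}) + card (Q ` (Mon - Sp))"
      unfolding W_def by (rule order_trans[OF card_Un_le add_right_mono[OF card_Un_le]])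
    also have "\<dots> \<le> card {1..<n} + card {..<n} + card (Mon - Sp)"
      using finMon by (intro add_mono card_image_le) auto
    also have "card (Mon - Sp) = N - 2 * n"
      using Sp finMon by (simp add: card_Diff_subset finite_subset N_def)
    also have "card {1..<n} + card {..<n} + (N - 2 * n) < N"
      using card_mono[OF finMon Sp(1)] Sp(2) ab by (simp add: N_def)
    finally show ?thesis .
  qed
  have UA: "U i \<in> ?A" if "i < n" for i
    using that by (intro gen_alg.gen) (cases "i = 0"; simp add: W_def)
  have VA: "V i \<in> ?A" if "i < n" for i
    using that by (intro gen_alg.gen) (simp add: W_def)
  have minor_A: "(\<lambda>(T, u, v). minor a b u v) \<in> ?A"
  proof -
    have "(\<lambda>x. U a x * V b x - U b x * V a x) \<in> ?A"
      by (intro gen_alg_diff gen_alg.mult UA VA ab)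
    then show ?thesis by (simp add: U_def V_def minor_def split_def)
  qed
  have change_A: "(\<lambda>(T, u, v). basis_change a b u v i j) \<in> ?A" if "i < n" for i j
  proof -
    have "(if j = a then U i else if j = b then V i else (\<lambda>_. if i = j then 1 else 0)) \<in> ?A"
      using UA VA that by (simp add: gen_alg.const)
    also have "(if j = a then U i else if j = b then V i else (\<lambda>_. if i = j then 1 else 0)) =
        (\<lambda>(T, u, v). basis_change a b u v i j)"
      by (auto simp: U_def V_def basis_change_def)
    finally show ?thesis .
  qed
  have cochange_A: "(\<lambda>(T, u, v). basis_cochange a b u v j l) \<in> ?A" if "j < n" for j l
  proof -
    let ?p = "\<lambda>x. (if l = a then 1 else 0) * V b x - (if l = b then 1 else 0) * V a x"
    let ?q = "\<lambda>x. (if l = b then 1 else 0) * U a x - (if l = a then 1 else 0) * U b x"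
    let ?m = "\<lambda>(T, u, v). minor a b u v"
    have p: "?p \<in> ?A" and q: "?q \<in> ?A"
      by (intro gen_alg_diff gen_alg.mult gen_alg.const UA VA ab)+
    have r: "(\<lambda>x. (if j = l then 1 else 0) * ?m x - U j x * ?p x - V j x * ?q x) \<in> ?A"
      by (intro gen_alg_diff gen_alg.mult gen_alg.const minor_A p q UA VA that)
    have "(if j = a then ?p else if j = b then ?q
        else (\<lambda>x. (if j = l then 1 else 0) * ?m x - U j x * ?p x - V j x * ?q x)) \<in> ?A"
      using p q r by simp
    also have "(if j = a then ?p else if j = b then ?q
        else (\<lambda>x. (if j = l then 1 else 0) * ?m x - U j x * ?p x - V j x * ?q x)) =
        (\<lambda>(T, u, v). basis_cochange a b u v j l)"
      by (auto simp: fun_eq_iff U_def V_def basis_cochange_def Let_def)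
    finally show ?thesis .
  qed
  \<comment> \<open>An entry in the new basis is either prescribed by one of the eigenvector
    equations, hence polynomial in the coordinates of \<open>u\<close> and \<open>v\<close>, or one
    of the generators \<open>Q\<close>.\<close>
  have transform_A: "\<exists>g\<in>?A. \<forall>(T, u, v)\<in>X. transform n (Suc D) a b T u v jx = g (T, u, v)"
    if jx: "jx \<in> tindices n (Suc D)" for jx
  proof -
    have B: "mset jx \<in> Mon" using jx by (simp add: Mon_def msets_of_degree_def)
    consider j where "j < n" "mset jx = add_mset j (replicate_mset D a)"
      | j where "j < n" "mset jx = add_mset j (replicate_mset D b)" | "mset jx \<in> Mon - Sp"
      using B by (auto simp: Sp_def special_msets_def)
    then show ?thesis
    proof cases
      case 1
      let ?g = "\<lambda>x. \<Sum>i<n. (\<lambda>(T, u, v). basis_change a b u v i j) x * U i x"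
      have "?g \<in> ?A" by (intro gen_alg_sum gen_alg.mult change_A UA) auto
      moreover have "transform n (Suc D) a b T u v jx = ?g (T, u, v)" if "(T, u, v) \<in> X" for T u v
      proof -
        have "transform n (Suc D) a b T u v jx = (\<Sum>i<n. basis_change a b u v i j * ccontract n D T u i)"
          by (rule transform_special[OF _ jx 1(2)]) (use that in \<open>auto simp: X_def basis_change_def\<close>)
        then show ?thesis using that by (simp add: X_def U_def)
      qed
      ultimately show ?thesis by (intro bexI[of _ ?g]) auto
    next
      case 2
      let ?g = "\<lambda>x. \<Sum>i<n. (\<lambda>(T, u, v). basis_change a b u v i j) x * (\<epsilon> * V i x)"
      have "?g \<in> ?A" by (intro gen_alg_sum gen_alg.mult gen_alg.const change_A VA) auto
      moreover have "transform n (Suc D) a b T u v jx = ?g (T, u, v)" if "(T, u, v) \<in> X" for T u v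
      proof -
        have "transform n (Suc D) a b T u v jx = (\<Sum>i<n. basis_change a b u v i j * ccontract n D T v i)"
          by (rule transform_special[OF _ jx 2(2)]) (use that ab in \<open>auto simp: X_def basis_change_def\<close>)
        then show ?thesis using that by (simp add: X_def V_def)
      qed
      ultimately show ?thesis by (intro bexI[of _ ?g]) auto
    next
      case 3
      have "Q (mset jx) \<in> ?A" using 3 by (intro gen_alg.gen) (simp add: W_def)
      moreover have "transform n (Suc D) a b T u v jx = Q (mset jx) (T, u, v)" if "(T, u, v) \<in> X" for T u v
        using transform_sym[of T n "Suc D" jx "sorted_list_of_multiset (mset jx)" a b u v] jx that
        by (simp add: Q_def X_def)
      ultimately show ?thesis by (intro bexI[of _ "Q (mset jx)"]) auto
    qed
  qed
  then have "\<forall>jx\<in>tindices n (Suc D). \<exists>g. g \<in> ?A \<and> (\<forall>(T, u, v)\<in>X. transform n (Suc D) a b T u v jx = g (T, u, v))"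
    by blast
  from bchoice[OF this] obtain G where G: "\<And>jx. jx \<in> tindices n (Suc D) \<Longrightarrow> G jx \<in> ?A"
    "\<And>jx T u v. jx \<in> tindices n (Suc D) \<Longrightarrow> (T, u, v) \<in> X \<Longrightarrow>
      transform n (Suc D) a b T u v jx = G jx (T, u, v)"
    by fast
  have "\<exists>r. (\<lambda>x. U 0 x * U 0 x) \<in> lin_span X (monomials W r)"
  proof -
    have "(\<lambda>x. (\<Sum>i<n. V i x * V i x) - (\<Sum>i\<in>{1..<n}. U i x * U i x)) \<in> gen_alg W"
      by (intro gen_alg_diff gen_alg_sum gen_alg.mult gen_alg.gen) (auto simp: W_def)
    from gen_alg_span_monomials[OF finW this, of X] obtain r where
      r: "(\<lambda>x. (\<Sum>i<n. V i x * V i x) - (\<Sum>i\<in>{1..<n}. U i x * U i x)) \<in> lin_span X (monomials W r)" by blast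
    have "(\<lambda>x. U 0 x * U 0 x) \<in> lin_span X (monomials W r)"
    proof (rule lin_span_cong[OF r])
      fix x assume "x \<in> X"
      moreover have "(\<Sum>i<n. U i x * U i x) = U 0 x * U 0 x + (\<Sum>i\<in>{1..<n}. U i x * U i x)"
        using ab(1) by (simp add: lessThan_atLeast0 sum.atLeast_Suc_lessThan)
      ultimately show "U 0 x * U 0 x = (\<Sum>i<n. V i x * V i x) - (\<Sum>i\<in>{1..<n}. U i x * U i x)"
        by (auto simp: X_def U_def V_def)
    qed
    then show ?thesis by blast
  qed
  then obtain r where "(\<lambda>x. U 0 x * U 0 x) \<in> lin_span X (monomials W r)" by blast
  then interpret quadratic_extension X W "U 0" r using finW by unfold_locales
  \<comment> \<open>Returning to the standard basis through the adjugate gives the entries of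
    \<open>T\<close> with the common denominator \<open>minor a b u v ^ Suc D\<close>.\<close>
  have dep: "\<exists>g\<in>?A. \<forall>x\<in>X. (\<lambda>(T, u, v). minor a b u v ^ Suc D) x * (\<lambda>(T, u, v). T (rep i)) x = g x"
    if i: "i < N" for i
  proof -
    let ?H = "\<lambda>t x. (\<lambda>(T, u, v). basis_cochange a b u v (fst t) (snd t)) x"
    let ?g = "\<lambda>x. \<Sum>jx\<in>tindices n (Suc D). G jx x * prod_list (map (\<lambda>t. ?H t x) (zip jx (rep i)))"
    have "?g \<in> ?A"
    proof (intro gen_alg_sum gen_alg.mult G gen_alg_prod_list cochange_A)
      fix jx t assume "jx \<in> tindices n (Suc D)" "t \<in> set (zip jx (rep i))"
      then show "fst t < n" using set_zip_leftD[of "fst t" "snd t" jx "rep i"] by (auto simp: tindices_def)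
    qed
    moreover have "minor a b u v ^ Suc D * T (rep i) = ?g (T, u, v)" if x: "(T, u, v) \<in> X" for T u v
      using transform_inverse[OF ab, of "rep i" "Suc D" T u v] rep[OF i] G(2)[OF _ x]
      by (simp add: split_def)
    ultimately show ?thesis by (intro bexI[of _ ?g]) auto
  qed
  have "(\<lambda>x. (\<lambda>(T, u, v). minor a b u v) x ^ Suc D) \<in> ?A" by (intro gen_alg_power minor_A)
  then have "(\<lambda>(T, u, v). minor a b u v ^ Suc D) \<in> ?A" by (simp add: split_def)
  from algebraic_dependence[OF cardW this, of "\<lambda>i (T, u, v). T (rep i)", OF dep]
  obtain E c k where k: "k < E ^ N" "c k \<noteq> 0"
    and c': "\<forall>x\<in>X. (\<lambda>(T, u, v). minor a b u v ^ Suc D) x \<noteq> 0 \<longrightarrow>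
      (\<Sum>k<E ^ N. c k * (\<Prod>i<N. (\<lambda>(T, u, v). T (rep i)) x ^ (k div E ^ i mod E))) = 0"
    by blast
  have c: "(\<Sum>k<E ^ N. c k * (\<Prod>i<N. T (rep i) ^ (k div E ^ i mod E))) = 0"
    if "(T, u, v) \<in> X" "minor a b u v \<noteq> 0" for T u v
    using bspec[OF c' that(1)] that(2) by simp
  define p where "p T = (\<Sum>k<E ^ N. c k * (\<Prod>i<N. T (rep i) ^ (k div E ^ i mod E)))" for T :: "nat list \<Rightarrow> complex"
  have "p \<in> poly_fun"
    unfolding p_def[abs_def] by (intro poly_fun_sum pf_mult pf_const poly_fun_prod poly_fun_power pf_coord)
  moreover have "\<exists>T\<in>sym_tensors n (Suc D). p T \<noteq> 0"
    using digit_polynomial_nonzero[OF h[unfolded Mon_def], of k E c] k rep unfolding p_def by blast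
  moreover have "p T = 0" if "T \<in> sym_tensors n (Suc D)" "\<forall>i<n. ccontract n D T u i = u i"
    "\<forall>i<n. ccontract n D T v i = \<epsilon> * v i" "(\<Sum>i<n. u i * u i) = (\<Sum>i<n. v i * v i)" "minor a b u v \<noteq> 0" for T u v
    unfolding p_def by (rule c[of T u v]) (use that in \<open>auto simp: X_def\<close>)
  ultimately show ?thesis by blast
qed

subsection \<open>Real critical points\<close>

text \<open>The form is homogeneous of degree d and the contraction of degree d - 1; the missing
  sign is that of \<open>- x\<close> on the right-hand side.\<close>

lemma crit_point_neg:
  assumes d: "d \<ge> 1" and x: "crit_point n d T x lam"
  shows "crit_point n d T (- x) ((- 1) ^ d * lam)"
proof -
  have neg: "prod_list (map (- x) ix) = (- 1) ^ length ix * prod_list (map x ix)" for ix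
    by (induction ix) auto
  have f: "tform n d T (- x) = (- 1) ^ d * tform n d T x"
    unfolding tform_def sum_distrib_left
    by (rule sum.cong) (auto simp: neg tindices_def)
  have g: "tcontract n d T (- x) i = (- 1) ^ (d - 1) * tcontract n d T x i" for i
    unfolding tcontract_def sum_distrib_left
    by (rule sum.cong) (auto simp: neg tindices_def)
  have "(- 1 :: real) ^ d = - ((- 1) ^ (d - 1))" using d by (cases d) auto
  then show ?thesis using x by (auto simp: crit_point_def f g on_sphere_def)
qed

lemma on_sphere_neq_zero: "on_sphere n x \<Longrightarrow> x \<noteq> (\<lambda>i. 0)"
  by (auto simp: on_sphere_def)

text \<open>Summing the squares of the coordinates, without conjugation, gives s^2 = t^2, as both
  points are real unit vectors.\<close>

lemma on_sphere_scaled_eq: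
  fixes s t :: complex
  assumes x: "on_sphere n x" and y: "on_sphere n y"
    and eq: "\<And>i. s * of_real (x i) = t * of_real (y i)" and s: "s \<noteq> 0"
  shows "(y, t) \<in> {(x, s), (- x, - s)}"
proof -
  have sq: "(\<Sum>i<n. (z * of_real (w i))\<^sup>2) = z\<^sup>2" if "on_sphere n w" for z :: complex and w
  proof -
    have "(\<Sum>i<n. (z * of_real (w i))\<^sup>2) = z\<^sup>2 * of_real (\<Sum>i<n. (w i)\<^sup>2)"
      by (simp add: power_mult_distrib sum_distrib_left)
    also have "(\<Sum>i<n. (w i)\<^sup>2) = 1" using that by (simp add: on_sphere_def)
    finally show ?thesis by simp
  qed
  have "s\<^sup>2 = t\<^sup>2" using sq[OF x, of s] sq[OF y, of t] eq by simp
  then consider "t = s" | "t = - s" by (metis power2_eq_iff)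
  then show ?thesis
  proof cases
    case 1
    then have "x i = y i" for i using eq[of i] s by simp
    then show ?thesis using 1 by auto
  next
    case 2
    have "y i = - x i" for i
    proof -
      have "s * of_real (x i) = s * of_real (- y i)" using eq[of i] 2 by simp
      then show ?thesis using s by (simp del: of_real_minus)
    qed
    then have "y = - x" by auto
    then show ?thesis using 2 by simp
  qed
qed

text \<open>If all minors vanish, then y_a x = x_a y for an index with x_a nonzero, and unit vectors
  so related agree up to sign.\<close>

lemma on_sphere_ex_minor:
  assumes x: "on_sphere n x" and y: "on_sphere n y" and ne: "y \<noteq> x" "y \<noteq> - x"
  shows "\<exists>a<n. \<exists>b<n. a \<noteq> b \<and> x a * y b - x b * y a \<noteq> 0"
proof (rule ccontr)
  assume "\<not> ?thesis"
  then have eq: "x a * y b = x b * y a" if "a < n" "b < n" for a b using that by force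
  obtain a where a: "x a \<noteq> 0" using on_sphere_neq_zero[OF x] by auto
  then have an: "a < n" using x by (auto simp: on_sphere_def not_less[symmetric])
  have "complex_of_real (y a) * of_real (x i) = of_real (x a) * of_real (y i)" for i
  proof (cases "i < n")
    case True then show ?thesis using eq[OF an True] by (simp add: mult.commute flip: of_real_mult)
  next
    case False then show ?thesis using x y by (simp add: on_sphere_def)
  qed
  then have "(x, complex_of_real (y a)) \<in> {(y, of_real (x a)), (- y, - of_real (x a))}"
    using a by (intro on_sphere_scaled_eq[OF y x]) auto
  then show False using ne by auto
qed

lemma ccontract_scaled:
  assumes T: "real_tensor T"
  shows "ccontract n (d - 1) T (\<lambda>i. s * of_real (x i)) i = s ^ (d - 1) * of_real (tcontract n d T x i)"
proof -
  have p: "prod_list (map (\<lambda>i. s * of_real (x i)) ix) = s ^ length ix * of_real (prod_list (map x ix))" for ix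
    by (induction ix) (auto simp: ac_simps)
  show ?thesis
    unfolding ccontract_def tcontract_def of_real_sum sum_distrib_left
  proof (rule sum.cong[OF refl])
    fix ix assume "ix \<in> tindices n (d - 1)"
    then have "length ix = d - 1" by (simp add: tindices_def)
    moreover have "T (i # ix) = of_real (Re (T (i # ix)))" using T by (simp add: real_tensor_def)
    ultimately show "T (i # ix) * prod_list (map (\<lambda>i. s * of_real (x i)) ix) =
        s ^ (d - 1) * of_real (Re (T (i # ix)) * prod_list (map x ix))"
      unfolding p by (metis mult.left_commute of_real_mult)
  qed
qed

text \<open>The factor \<open>s\<close> is normalised by \<open>lam\<close> even if the value at
  \<open>x\<close> is \<open>mu\<close>. Thus two points with values \<open>lam\<close> and
  \<open>- lam\<close> can share one \<open>s\<close>, the sign going into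
  \<open>\<epsilon>\<close>.\<close>

lemma ccontract_crit_point:
  assumes T: "real_tensor T" and x: "crit_point n d T x mu" and d: "d \<ge> 2"
    and s: "s ^ (d - 2) * of_real lam = 1" and i: "i < n" and mu: "mu = \<epsilon> * lam"
  shows "ccontract n (d - 1) T (\<lambda>i. s * of_real (x i)) i = of_real \<epsilon> * (s * of_real (x i))"
proof -
  have "d - 1 = Suc (d - 2)" using d by simp
  then have "s ^ (d - 1) = s * s ^ (d - 2)" by simp
  moreover have "tcontract n d T x i = mu * x i" using x i by (simp add: crit_point_def)
  ultimately have "ccontract n (d - 1) T (\<lambda>i. s * of_real (x i)) i = s * s ^ (d - 2) * of_real (mu * x i)"
    unfolding ccontract_scaled[OF T] by simp
  also have "\<dots> = (s ^ (d - 2) * of_real lam) * (of_real \<epsilon> * (s * of_real (x i)))"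
    by (simp add: mu ac_simps)
  finally show ?thesis using s by simp
qed

definition crit_points :: "nat \<Rightarrow> nat \<Rightarrow> (nat list \<Rightarrow> complex) \<Rightarrow> (nat \<Rightarrow> real) set" where
  "crit_points n d T = {x. \<exists>lam. lam \<noteq> 0 \<and> crit_point n d T x lam}"

text \<open>A critical point \<open>x\<close> with value \<open>\<lambda>\<close> gives the \<open>d - 2\<close> solutions \<open>s * x\<close> with
  \<open>s ^ (d - 2) = 1 / \<lambda>\<close>, and a solution arises only from \<open>(x, s)\<close> and \<open>(- x, - s)\<close>.\<close>

lemma card_crit_points_le:
  assumes d: "d \<ge> 3" and T: "real_tensor T"
    and bound: "\<And>S. finite S \<Longrightarrow> S \<subseteq> eigen_solutions n (d - 1) T \<Longrightarrow> card S \<le> (d - 1) ^ n"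
    and F: "finite F" "F \<subseteq> crit_points n d T"
  shows "card F * (d - 2) \<le> 2 * ((d - 1) ^ n - 1)"
proof -
  define val where "val x = tform n d T x" for x
  have F': "crit_point n d T x (val x)" "val x \<noteq> 0" if "x \<in> F" for x
    using F(2) that by (auto simp: crit_points_def val_def crit_point_def)
  define R where "R x = {s::complex. s ^ (d - 2) = 1 / of_real (val x)}" for x
  have R: "card (R x) = d - 2" "finite (R x)" if "x \<in> F" for x
  proof -
    show "card (R x) = d - 2" unfolding R_def using F'(2)[OF that] d by (intro card_nth_roots) auto
    then show "finite (R x)" using d by (intro card_ge_0_finite) simp
  qed
  define P where "P = Sigma F R"
  have cardP: "card P = card F * (d - 2)" and finP: "finite P"
    using F(1) R by (simp_all add: P_def finite_SigmaI)
  define \<Phi> where "\<Phi> = (\<lambda>(x, s) (i::nat). s * complex_of_real (x i))"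
  have P: "crit_point n d T x (val x)" "on_sphere n x" "s \<noteq> 0" "s ^ (d - 2) * of_real (val x) = 1"
    if "(x, s) \<in> P" for x s
  proof -
    have xs: "x \<in> F" "s ^ (d - 2) = 1 / of_real (val x)" using that by (auto simp: P_def R_def)
    show "crit_point n d T x (val x)" by (rule F'(1)[OF xs(1)])
    then show "on_sphere n x" by (simp add: crit_point_def)
    show one: "s ^ (d - 2) * of_real (val x) = 1" using xs F'(2)[OF xs(1)] by simp
    show "s \<noteq> 0" using one d by (cases "s = 0") (simp_all add: power_0_left)
  qed
  have sol: "\<Phi> ` P \<subseteq> eigen_solutions n (d - 1) T - {\<lambda>i. 0}"
  proof (rule image_subsetI)
    fix p assume "p \<in> P"
    then obtain x s where p: "p = (x, s)" "(x, s) \<in> P" by (cases p) auto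
    have "\<Phi> p \<in> eigen_solutions n (d - 1) T"
      using ccontract_crit_point[OF T P(1)[OF p(2)] _ P(4)[OF p(2)], of _ 1] P(2)[OF p(2)] d
      by (auto simp: eigen_solutions_def p \<Phi>_def on_sphere_def)
    moreover have "\<Phi> p \<noteq> (\<lambda>i. 0)"
      using on_sphere_neq_zero[OF P(2)[OF p(2)]] P(3)[OF p(2)] by (auto simp: p \<Phi>_def fun_eq_iff)
    ultimately show "\<Phi> p \<in> eigen_solutions n (d - 1) T - {\<lambda>i. 0}" by simp
  qed
  \<comment> \<open>The zero solution lies outside the image of \<open>\<Phi>\<close> and so lowers
    the bound for that image by one.\<close>
  have "(\<lambda>i. 0) \<in> eigen_solutions n (d - 1) T"
  proof -
    have "prod_list (map (\<lambda>i. 0) ix) = (0::complex)" if "ix \<in> tindices n (d - 1)" for ix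
      using that d by (cases ix) (auto simp: tindices_def)
    then show ?thesis by (simp add: eigen_solutions_def ccontract_def)
  qed
  then have "card (insert (\<lambda>i. 0) (\<Phi> ` P)) \<le> (d - 1) ^ n"
    using sol finP by (intro bound) auto
  moreover have "card (insert (\<lambda>i. 0) (\<Phi> ` P)) = Suc (card (\<Phi> ` P))"
    using sol finP by (intro card_insert_disjoint) auto
  ultimately have card\<Phi>: "card (\<Phi> ` P) \<le> (d - 1) ^ n - 1" by simp
  have fibre: "card {p \<in> P. \<Phi> p = z} \<le> 2" if z: "z \<in> \<Phi> ` P" for z
  proof -
    obtain p where p: "p \<in> P" "z = \<Phi> p" using z by blast
    obtain x s where "p = (x, s)" by (cases p)
    then have xs: "(x, s) \<in> P" "z = \<Phi> (x, s)" using p by simp_all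
    have "{p \<in> P. \<Phi> p = z} \<subseteq> {(x, s), (- x, - s)}"
    proof
      fix p assume p: "p \<in> {p \<in> P. \<Phi> p = z}"
      obtain y t where yt: "p = (y, t)" by (cases p)
      have "s * of_real (x i) = t * of_real (y i)" for i
        using p xs by (auto simp: yt \<Phi>_def dest: fun_cong[of _ _ i])
      then show "p \<in> {(x, s), (- x, - s)}"
        unfolding yt using p yt by (intro on_sphere_scaled_eq[OF P(2)[OF xs(1)] P(2)[of y t]] P(3)[OF xs(1)]) auto
    qed
    then have "card {p \<in> P. \<Phi> p = z} \<le> card {(x, s), (- x, - s)}" by (intro card_mono) auto
    also have "\<dots> \<le> 2" by (rule card_insert_le_m1) auto
    finally show ?thesis .
  qed
  have "P = (\<Union>z\<in>\<Phi> ` P. {p \<in> P. \<Phi> p = z})" by auto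
  then have "card P \<le> (\<Sum>z\<in>\<Phi> ` P. card {p \<in> P. \<Phi> p = z})"
    using card_UN_le[of "\<Phi> ` P" "\<lambda>z. {p \<in> P. \<Phi> p = z}"] finP by simp
  also have "\<dots> \<le> (\<Sum>z\<in>\<Phi> ` P. 2)" by (rule sum_mono) (rule fibre)
  also have "\<dots> \<le> 2 * ((d - 1) ^ n - 1)" using card\<Phi> by simp
  finally show ?thesis using cardP by simp
qed

text \<open>The estimate concerns critical points; it passes to values because \<open>tform\<close>
  maps the points onto them.\<close>

lemma nonzero_crit_values_bound:
  assumes d: "d \<ge> 3" and T: "real_tensor T"
    and bound: "\<And>S. finite S \<Longrightarrow> S \<subseteq> eigen_solutions n (d - 1) T \<Longrightarrow> card S \<le> (d - 1) ^ n"
  shows "finite (nonzero_crit_values n d T)"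
    "real (card (nonzero_crit_values n d T)) \<le> 2 * ((real d - 1) ^ n - 1) / (real d - 2)"
proof -
  have le: "card F * (d - 2) \<le> 2 * ((d - 1) ^ n - 1)" if "finite F" "F \<subseteq> crit_points n d T" for F
    using card_crit_points_le[OF d T _ that] bound by blast
  have fin: "finite (crit_points n d T)"
  proof (rule ccontr)
    assume "infinite (crit_points n d T)"
    \<comment> \<open>One point more than the estimate allows, given that \<open>d - 2\<close> is at
      least 1.\<close>
    then obtain F where F: "finite F" "card F = 2 * ((d - 1) ^ n - 1) + 1" "F \<subseteq> crit_points n d T"
      using infinite_arbitrarily_large by blast
    have "card F * 1 \<le> card F * (d - 2)" using d by (intro mult_le_mono2) simp
    then show False using le[OF F(1) F(3)] F(2) by linarith
  qed
  have sub: "nonzero_crit_values n d T \<subseteq> tform n d T ` crit_points n d T"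
    by (auto simp: nonzero_crit_values_def crit_points_def crit_point_def)
  then show "finite (nonzero_crit_values n d T)" using fin finite_surj by blast
  have "card (nonzero_crit_values n d T) \<le> card (crit_points n d T)"
    using surj_card_le[OF fin sub] .
  then have "card (nonzero_crit_values n d T) * (d - 2) \<le> 2 * ((d - 1) ^ n - 1)"
    using le[OF fin order_refl] by (meson le_trans mult_le_mono1)
  then have "real (card (nonzero_crit_values n d T) * (d - 2)) \<le> real (2 * ((d - 1) ^ n - 1))"
    by (rule of_nat_mono)
  moreover have "real ((d - 1) ^ n - 1) = (real d - 1) ^ n - 1"
    using d by (simp add: of_nat_diff Suc_leI)
  ultimately show "real (card (nonzero_crit_values n d T)) \<le> 2 * ((real d - 1) ^ n - 1) / (real d - 2)"
    using d by (simp add: pos_le_divide_eq of_nat_diff)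
qed

text \<open>If \<open>y\<close> were neither \<open>x\<close> nor \<open>- x\<close>, some 2x2 minor
  would be nonzero. Scaling both points by the same root \<open>s\<close> then produces precisely a
  pair that \<open>no_pair\<close> excludes.\<close>

lemma crit_points_pm_eq:
  assumes d: "d \<ge> 3" and T: "T \<in> sym_tensors n d" "real_tensor T"
    and no_pair: "\<And>a b \<epsilon> u v. a < n \<Longrightarrow> b < n \<Longrightarrow> a \<noteq> b \<Longrightarrow> \<epsilon> \<in> {1, - 1} \<Longrightarrow>
      (\<forall>i<n. ccontract n (d - 1) T u i = u i) \<Longrightarrow> (\<forall>i<n. ccontract n (d - 1) T v i = of_real \<epsilon> * v i) \<Longrightarrow>
      (\<Sum>i<n. u i * u i) = (\<Sum>i<n. v i * v i) \<Longrightarrow> minor a b u v = 0"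
    and x: "crit_point n d T x lam" and y: "crit_point n d T y mu"
    and lam: "lam \<noteq> 0" "\<bar>mu\<bar> = \<bar>lam\<bar>"
  shows "y = x \<or> y = - x"
proof (rule ccontr)
  assume "\<not> ?thesis"
  then have ne: "y \<noteq> x" "y \<noteq> - x" by auto
  have xs: "on_sphere n x" and ys: "on_sphere n y" using x y by (auto simp: crit_point_def)
  obtain a b where ab: "a < n" "b < n" "a \<noteq> b" and m: "x a * y b - x b * y a \<noteq> 0"
    using on_sphere_ex_minor[OF xs ys ne] by blast
  have "mu = 1 * lam \<or> mu = - 1 * lam" using lam(2) by (auto simp: abs_eq_iff)
  then obtain \<epsilon> where \<epsilon>: "\<epsilon> \<in> {1, - 1}" "mu = \<epsilon> * lam" by blast
  have "card {s::complex. s ^ (d - 2) = 1 / of_real lam} = d - 2"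
    using lam d by (intro card_nth_roots) auto
  then have "{s::complex. s ^ (d - 2) = 1 / of_real lam} \<noteq> {}" using d by (intro notI) simp
  then obtain s :: complex where "s ^ (d - 2) = 1 / of_real lam" by blast
  then have s: "s ^ (d - 2) * of_real lam = 1" using lam by simp
  then have s0: "s \<noteq> 0" using d by (cases "s = 0") (simp_all add: power_0_left)
  let ?u = "\<lambda>i. s * of_real (x i)" and ?v = "\<lambda>i. s * of_real (y i)"
  have sq: "(\<Sum>i<n. s * of_real (w i) * (s * of_real (w i))) = s * s" if "on_sphere n w" for w
  proof -
    have "(\<Sum>i<n. s * of_real (w i) * (s * of_real (w i))) = s * s * of_real (\<Sum>i<n. (w i)\<^sup>2)"
      by (simp add: sum_distrib_left power2_eq_square ac_simps)
    also have "(\<Sum>i<n. (w i)\<^sup>2) = 1" using that by (simp add: on_sphere_def)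
    finally show ?thesis by simp
  qed
  have "minor a b ?u ?v = 0"
  proof (rule no_pair[OF ab \<epsilon>(1)])
    show "\<forall>i<n. ccontract n (d - 1) T ?u i = ?u i"
      using ccontract_crit_point[OF T(2) x _ s, of _ 1] d by simp
    show "\<forall>i<n. ccontract n (d - 1) T ?v i = of_real \<epsilon> * ?v i"
      using ccontract_crit_point[OF T(2) y _ s _ \<epsilon>(2)] d by simp
    show "(\<Sum>i<n. ?u i * ?u i) = (\<Sum>i<n. ?v i * ?v i)" using sq xs ys by simp
  qed
  moreover have "minor a b ?u ?v = s * s * of_real (x a * y b - x b * y a)"
    by (simp add: minor_def algebra_simps)
  ultimately show False using s0 m by (metis mult_eq_0_iff of_real_eq_0_iff)
qed

section \<open>Merging the exceptional conditions into one hypersurface\<close>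

theorem theorem6p2:
  fixes n d :: nat
  assumes "d \<ge> 3" and "n \<ge> 2"
  shows "\<exists>\<Sigma>. proper_subvariety n d \<Sigma> \<and>
    (\<forall>T\<in>sym_tensors n d. real_tensor T \<and> T \<notin> \<Sigma> \<longrightarrow>
       finite (nonzero_crit_values n d T) \<and>
       real (card (nonzero_crit_values n d T)) \<le> 2 * ((real d - 1) ^ n - 1) / (real d - 2) \<and>
       (odd d \<longrightarrow> (\<forall>lam\<in>nonzero_crit_values n d T.
           \<exists>x. {y. crit_point n d T y lam} = {x} \<and>
               {y. crit_point n d T y (- lam)} = {- x})) \<and>
       (even d \<longrightarrow> (\<forall>lam\<in>nonzero_crit_values n d T.
           \<exists>x. {y. crit_point n d T y lam} = {x, - x}) \<and>
         (\<forall>lam\<in>nonzero_crit_values n d T. \<forall>mu\<in>nonzero_crit_values n d T.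
           lam \<noteq> mu \<longrightarrow> \<bar>lam\<bar> \<noteq> \<bar>mu\<bar>)))"
proof -
  define D where "D = d - 1"
  have D: "D \<ge> 2" "d = Suc D" using assms by (auto simp: D_def)
  obtain q where q: "q \<in> poly_fun" "\<exists>T\<in>sym_tensors n d. q T \<noteq> 0"
    and q_bound: "\<And>T S. q T \<noteq> 0 \<Longrightarrow> finite S \<Longrightarrow> S \<subseteq> eigen_solutions n D T \<Longrightarrow> card S \<le> D ^ n"
    using generic_eigen_bound[OF D(1), of n] unfolding D(2)[symmetric] by blast
  \<comment> \<open>Independence of \<open>u\<close> and \<open>v\<close> means that some minor is
    nonzero, and equal absolute values mean one of two signs. Each of these finitely many cases has
    its own polynomial.\<close>
  define I where "I = {(a, b, \<epsilon>). a < n \<and> b < n \<and> a \<noteq> b \<and> \<epsilon> \<in> {1, - 1 :: real}}"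
  define bad where "bad = (\<lambda>(a, b, \<epsilon>) T. \<exists>u v.
      (\<forall>i<n. ccontract n D T u i = u i) \<and> (\<forall>i<n. ccontract n D T v i = of_real (\<epsilon> :: real) * v i) \<and>
      (\<Sum>i<n. u i * u i) = (\<Sum>i<n. v i * v i) \<and> minor a b u v \<noteq> 0)"
  have "\<exists>p\<in>poly_fun. (\<exists>T\<in>sym_tensors n d. p T \<noteq> 0) \<and> (\<forall>T\<in>sym_tensors n d. bad k T \<longrightarrow> p T = 0)"
    if "k \<in> I" for k
  proof -
    obtain a b \<epsilon> where k: "k = (a, b, \<epsilon>)" "a < n" "b < n" "a \<noteq> b" using \<open>k \<in> I\<close> by (auto simp: I_def)
    show ?thesis
      using generic_no_pair[OF D(1) k(2-4), of "of_real \<epsilon>"] unfolding D(2)[symmetric] bad_def k(1) split by blast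
  qed
  then have "\<forall>k\<in>I. \<exists>p. p \<in> poly_fun \<and> (\<exists>T\<in>sym_tensors n d. p T \<noteq> 0) \<and>
      (\<forall>T\<in>sym_tensors n d. bad k T \<longrightarrow> p T = 0)" by blast
  from bchoice[OF this] obtain p where p: "\<And>k. k \<in> I \<Longrightarrow> p k \<in> poly_fun"
    "\<And>k. k \<in> I \<Longrightarrow> \<exists>T\<in>sym_tensors n d. p k T \<noteq> 0"
    "\<And>k T. k \<in> I \<Longrightarrow> T \<in> sym_tensors n d \<Longrightarrow> bad k T \<Longrightarrow> p k T = 0" by blast
  have "finite I"
    by (rule finite_subset[of _ "{..<n} \<times> {..<n} \<times> {1, - 1}"]) (auto simp: I_def)
  then obtain A where A: "A \<in> sym_tensors n d" "(\<Prod>k\<in>I. p k A) \<noteq> 0"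
    using poly_fun_prod_nonzero[of I p n d] p by blast
  have prod: "(\<lambda>T. \<Prod>k\<in>I. p k T) \<in> poly_fun" by (intro poly_fun_prod p)
  \<comment> \<open>By irreducibility the product of all these polynomials is still nonzero
    somewhere on the symmetric tensors, so its zero set is a proper subvariety.\<close>
  define P where "P T = q T * (\<Prod>k\<in>I. p k T)" for T
  have P: "P \<in> poly_fun" unfolding P_def[abs_def] by (intro pf_mult q prod)
  have P0: "\<exists>T\<in>sym_tensors n d. P T \<noteq> 0"
    using q A poly_fun_mult_nonzero[OF q(1) prod _ _ A] unfolding P_def by blast
  define \<Sigma> where "\<Sigma> = {T \<in> sym_tensors n d. \<forall>p\<in>{P}. p T = 0}"
  have "proper_subvariety n d \<Sigma>"
    unfolding proper_subvariety_def
  proof (intro conjI exI[of _ "{P}"])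
    show "\<Sigma> \<noteq> sym_tensors n d" using P0 by (auto simp: \<Sigma>_def)
  qed (use P in \<open>auto simp: \<Sigma>_def\<close>)
  moreover have "finite (nonzero_crit_values n d T) \<and>
       real (card (nonzero_crit_values n d T)) \<le> 2 * ((real d - 1) ^ n - 1) / (real d - 2) \<and>
       (odd d \<longrightarrow> (\<forall>lam\<in>nonzero_crit_values n d T.
           \<exists>x. {y. crit_point n d T y lam} = {x} \<and>
               {y. crit_point n d T y (- lam)} = {- x})) \<and>
       (even d \<longrightarrow> (\<forall>lam\<in>nonzero_crit_values n d T.
           \<exists>x. {y. crit_point n d T y lam} = {x, - x}) \<and>
         (\<forall>lam\<in>nonzero_crit_values n d T. \<forall>mu\<in>nonzero_crit_values n d T.
           lam \<noteq> mu \<longrightarrow> \<bar>lam\<bar> \<noteq> \<bar>mu\<bar>))"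
    if T: "T \<in> sym_tensors n d" "real_tensor T" "T \<notin> \<Sigma>" for T
  proof -
    have "P T \<noteq> 0" using T by (simp add: \<Sigma>_def)
    then have qT: "q T \<noteq> 0" and pT: "\<And>k. k \<in> I \<Longrightarrow> p k T \<noteq> 0"
      using \<open>finite I\<close> by (auto simp: P_def)
    have bound: "card S \<le> (d - 1) ^ n" if "finite S" "S \<subseteq> eigen_solutions n (d - 1) T" for S
      using q_bound[OF qT that(1)] that(2) by (simp add: D_def)
    have not_bad: "\<not> bad k T" if "k \<in> I" for k using p(3)[OF that T(1)] pT[OF that] by blast
    have pm: "y = x \<or> y = - x"
      if "crit_point n d T x lam" "crit_point n d T y mu" "lam \<noteq> 0" "\<bar>mu\<bar> = \<bar>lam\<bar>" for x y lam mu
    proof (rule crit_points_pm_eq[OF assms(1) T(1,2) _ that])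
      fix a b :: nat and \<epsilon> :: real and u v :: "nat \<Rightarrow> complex"
      assume *: "a < n" "b < n" "a \<noteq> b" "\<epsilon> \<in> {1, - 1}" "\<forall>i<n. ccontract n (d - 1) T u i = u i"
        "\<forall>i<n. ccontract n (d - 1) T v i = of_real \<epsilon> * v i" "(\<Sum>i<n. u i * u i) = (\<Sum>i<n. v i * v i)"
      have "(a, b, \<epsilon>) \<in> I" using * by (simp add: I_def)
      from not_bad[OF this] * show "minor a b u v = 0" unfolding bad_def D_def by blast
    qed
    have neg: "crit_point n d T (- x) ((- 1) ^ d * lam)" if "crit_point n d T x lam" for x lam
      using crit_point_neg[OF _ that] assms(1) by simp
    have val: "lam = mu" if "crit_point n d T x lam" "crit_point n d T x mu" for x lam mu
      using that by (simp add: crit_point_def)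
    have "\<exists>x. {y. crit_point n d T y lam} = {x} \<and> {y. crit_point n d T y (- lam)} = {- x}"
      if odd: "odd d" and lam: "lam \<in> nonzero_crit_values n d T" for lam
    proof -
      obtain x where x: "lam \<noteq> 0" "crit_point n d T x lam" using lam by (auto simp: nonzero_crit_values_def)
      have nx: "crit_point n d T (- x) (- lam)" using neg[OF x(2)] odd by simp
      \<comment> \<open>The antipode drops out: its value is \<open>- lam\<close>, which differs
        from the nonzero \<open>lam\<close>.\<close>
      have "y = x" if "crit_point n d T y lam" for y
        using pm[OF x(2) that x(1)] val[OF nx, of lam] that x(1) by auto
      moreover have "y = - x" if "crit_point n d T y (- lam)" for y
        using pm[OF x(2) that x(1)] val[OF x(2), of "- lam"] that x(1) by auto
      ultimately show ?thesis using x nx by blast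
    qed
    moreover have "\<exists>x. {y. crit_point n d T y lam} = {x, - x}"
      if even: "even d" and lam: "lam \<in> nonzero_crit_values n d T" for lam
    proof -
      obtain x where x: "lam \<noteq> 0" "crit_point n d T x lam" using lam by (auto simp: nonzero_crit_values_def)
      have nx: "crit_point n d T (- x) lam" using neg[OF x(2)] even by simp
      have "y = x \<or> y = - x" if "crit_point n d T y lam" for y
        using pm[OF x(2) that x(1)] by simp
      then show ?thesis using x nx by blast
    qed
    moreover have "\<bar>lam\<bar> \<noteq> \<bar>mu\<bar>"
      if even: "even d" and lam: "lam \<in> nonzero_crit_values n d T" "mu \<in> nonzero_crit_values n d T"
        and ne: "lam \<noteq> mu" for lam mu
    proof
      assume eq: "\<bar>lam\<bar> = \<bar>mu\<bar>"
      obtain x where x: "lam \<noteq> 0" "crit_point n d T x lam" using lam by (auto simp: nonzero_crit_values_def)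
      obtain y where y: "crit_point n d T y mu" using lam by (auto simp: nonzero_crit_values_def)
      have nx: "crit_point n d T (- x) lam" using neg[OF x(2)] even by simp
      \<comment> \<open>The point \<open>y\<close> is \<open>x\<close> or \<open>- x\<close>; for
        even \<open>d\<close> both have value \<open>lam\<close>, and a point has only one
        value.\<close>
      from pm[OF x(2) y x(1)] eq show False using val y x(2) nx ne by metis
    qed
    ultimately show ?thesis
      using nonzero_crit_values_bound[OF assms(1) T(2) bound] by blast
  qed
  ultimately show ?thesis by blast
qed

end
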